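(* Let $\{a_n\}_{n\in\mathbb{N}}\in l_1$ be a sequence of complex numbers, i.e. $\sum_{m\ge1}|a_m|<\infty$. Then for every $n\in\mathbb{N}$ its general term can be expanded, with convergence in the sense of Abel, as $$a_n=\frac{4}{\pi^2 n}\lim_{\alpha\to\frac{\pi}{2}-}\int_0^\infty \tau\sinh\left(\frac{\pi\tau}{2}\right)\cosh(\alpha\tau)\,K_s\left(n,i\tau,\sinh^{-1}(\pi)\right)\sum_{m=1}^\infty a_m K_{i\tau}(m)\,d\tau .$$ Moreover, under the stronger condition $$\sum_{m=1}^\infty m|a_m|<\infty$$ the expansion $$a_n=\frac{2}{\pi^2 n}\int_0^\infty \tau\sinh(\pi\tau)\,K_{i\tau}(n)\sum_{m=1}^\infty a_m K_s\left(m,i\tau,\sinh^{-1}(\pi)\right)d\tau$$ holds for every $n\in\mathbb{N}$, where the convergence of the integral is in the improper sense.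
   Context: $\mathbb{N}=\{1,2,\dots\}$, $i$ is the imaginary unit and $\sinh^{-1}(u)=\log\left(u+\sqrt{1+u^2}\right)$. $K_\nu$ is the modified Bessel (Macdonald) function, $K_\nu(x)=\int_0^\infty e^{-x\cosh u}\cosh(\nu u)\,du$ for $x>0$, $\nu\in\mathbb{C}$; thus $K_{i\tau}(n)=\int_0^\infty e^{-n\cosh u}\cos(\tau u)\,du$. The function $K_s$ is defined by $K_s(x,\nu,w)=\frac{1}{\sin(\pi\nu/2)}\int_0^w\sin(x\sinh u)\sinh(\nu u)\,du$; thus, for $\tau>0$, $K_s(n,i\tau,w)=\frac{1}{\sinh(\pi\tau/2)}\int_0^w\sin(n\sinh u)\sin(\tau u)\,du$. Improper sense means $\int_0^\infty=\lim_{N\to\infty}\int_0^N$. *)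

theory Defs
  imports "HOL-Analysis.Analysis"
begin

definition macdonald_K :: "complex \<Rightarrow> real \<Rightarrow> complex" where
  "macdonald_K \<nu> x =
     (LBINT u:{0..}. of_real (exp (- x * cosh u)) * cosh (\<nu> * of_real u))"

text \<open>
  For \<open>\<nu> = \<i> * \<tau>\<close> with \<open>\<tau> > 0\<close> the factor \<open>sin (pi * \<nu> / 2) = \<i> * sinh (pi * \<tau> / 2)\<close> does
  not vanish. At \<open>\<nu> = 0\<close> division by zero gives the value \<open>0\<close> instead of the continuous
  extension; integrals over \<open>\<tau>\<close> are unaffected by this single point.
\<close>

definition macdonald_Ks :: "real \<Rightarrow> complex \<Rightarrow> real \<Rightarrow> complex" where
  "macdonald_Ks x \<nu> w =
     1 / sin (of_real pi * \<nu> / 2) *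
     (LBINT u:{0..w}. of_real (sin (x * sinh u)) * sinh (\<nu> * of_real u))"

end

theory Submission
  imports Defs "HOL-Probability.Sinc_Integral" "HOL-Complex_Analysis.Complex_Analysis"
begin

text \<open>
  Write \<open>w = arsinh pi\<close>, so that \<open>y = sinh u\<close> maps \<open>{0..w}\<close> onto \<open>{0..pi}\<close>. Both expansions are
  Parseval identities for the Fourier cosine transform, followed by the orthogonality of the
  functions \<open>cos (m y)\<close> on \<open>{0..pi}\<close>.

  On one side, rotating the line of integration in \<open>K\<^bsub>i\<tau>\<^esub>(x) = 1/2 \<integral> exp (- x cosh v + i \<tau> v) dv\<close>
  to height \<open>\<alpha> < pi / 2\<close> shows that \<open>2 cosh (\<alpha> \<tau>) K\<^bsub>i\<tau>\<^esub>(x)\<close> is the cosine transform over the real line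
  of \<open>h\<^sub>\<alpha>(v) = exp (- x cosh v cos \<alpha>) cos (x sinh v sin \<alpha>)\<close>
  (lemma \<open>rotated_exp_cosh_cosine_transform\<close>), which tends to \<open>cos (x sinh v)\<close> as
  \<open>\<alpha> \<rightarrow> pi / 2\<close>. On the other side, an integration by parts, whose boundary terms vanish because
  \<open>sin (m sinh w) = sin (m pi) = 0\<close>, gives
  \<open>\<tau> sinh (pi \<tau> / 2) K\<^sub>s(m, i\<tau>, w) = m C\<^sub>m(\<tau>)\<close>, where \<open>C\<^sub>m\<close> is the cosine transform of
  \<open>cosh u cos (m sinh u)\<close> on \<open>{0..w}\<close> (lemma \<open>sinh_times_macdonald_Ks\<close>). Both integrands are
  therefore series in the products \<open>cosh (\<alpha> \<tau>) K\<^bsub>i\<tau>\<^esub>(x) C\<^sub>m(\<tau>)\<close>, with \<open>\<alpha> < pi / 2\<close> for the Abel limit and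
  \<open>\<alpha> = pi / 2\<close> for the improper integral, since \<open>sinh (pi \<tau>) = 2 sinh (pi \<tau> / 2) cosh (pi \<tau> / 2)\<close>.

  The analytic core is the inversion
  \<open>P\<^sub>N(u) = \<integral>\<^sub>0\<^sup>N cosh (\<alpha> \<tau>) K\<^bsub>i\<tau>\<^esub>(x) cos (\<tau> u) d\<tau> \<rightarrow> (pi / 2) h\<^sub>\<alpha>(u)\<close>, boundedly for \<open>u \<in> {0..w}\<close>, which is
  needed up to and including \<open>\<alpha> = pi / 2\<close>, where \<open>h\<^sub>\<alpha>\<close> is not integrable. For \<open>\<alpha> < pi / 2\<close> the
  integral \<open>P\<^sub>N\<close> is a Dirichlet integral of \<open>h\<^sub>\<alpha>\<close> over the real line; the part outside \<open>{-V..V}\<close> is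
  \<open>O((sinh V)\<^bsup>-1/2\<^esup>)\<close> uniformly in \<open>N\<close> and \<open>u\<close>, and locally uniformly in \<open>\<alpha> \<in> {0<..pi / 2}\<close>, by
  van der Corput's second derivative test
  applied to the phases \<open>x sinh v sin \<alpha> \<plusminus> N (v - u)\<close> (lemmas \<open>van_der_Corput_sin\<close> and
  \<open>rotated_exp_cosh_dirichlet_tail\<close>). The uniform estimate survives the passage to
  \<open>\<alpha> = pi / 2\<close> (lemma \<open>truncated_inverse_approx\<close>), and on the compact part the classical theory
  of the Dirichlet kernel applies.

  Integrating \<open>P\<^sub>N\<close> against \<open>cosh u cos (m sinh u)\<close> gives
  \<open>\<integral>\<^sub>0\<^sup>N cosh (\<alpha> \<tau>) K\<^bsub>i\<tau>\<^esub>(x) C\<^sub>m(\<tau>) d\<tau> \<rightarrow> (pi / 2) \<integral>\<^sub>0\<^sup>w cosh u cos (m sinh u) h\<^sub>\<alpha>(u) du\<close> with bounds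
  uniform in \<open>m\<close> and \<open>N\<close>. For \<open>m \<ge> 1\<close>, \<open>x = n \<ge> 1\<close> and \<open>\<alpha> = pi / 2\<close> the right-hand side is \<open>pi\<^sup>2 / 4\<close> if
  \<open>m = n\<close> and \<open>0\<close> otherwise. In the first expansion the summation index is \<open>x\<close>, the coefficients are
  \<open>a\<^sub>x\<close>, and \<open>\<alpha> \<rightarrow> pi / 2\<close> after \<open>N \<rightarrow> \<infinity>\<close>; in the second the summation index is \<open>m\<close>, the coefficients are
  \<open>m a\<^sub>m\<close>, and \<open>N \<rightarrow> \<infinity>\<close> at \<open>\<alpha> = pi / 2\<close>. Tannery's theorem exchanges these limits with the sums, and the
  hypotheses on \<open>a\<close> provide the absolute summability of the coefficients.
\<close>

section \<open>Van der Corput estimates for oscillatory integrals\<close>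

text \<open>
  Integrate \<open>sin \<theta> = (sin \<theta> \<cdot> \<theta>') / \<theta>'\<close> by parts. Since \<open>\<theta>'' \<ge> 0\<close>, the remaining integral of
  \<open>cos \<theta> \<cdot> \<theta>'' / \<theta>'\<^sup>2\<close> is dominated by that of \<open>\<theta>'' / \<theta>'\<^sup>2\<close>, which is exact.
\<close>

lemma oscillatory_integral_first_derivative:
  fixes \<theta> \<theta>' \<theta>'' :: "real \<Rightarrow> real"
  assumes ab: "a \<le> b" and mu: "\<mu> > 0"
    and d1: "\<And>x. x \<in> {a..b} \<Longrightarrow> (\<theta> has_real_derivative \<theta>' x) (at x within {a..b})"
    and d2: "\<And>x. x \<in> {a..b} \<Longrightarrow> (\<theta>' has_real_derivative \<theta>'' x) (at x within {a..b})"
    and low: "\<And>x. x \<in> {a..b} \<Longrightarrow> \<mu> \<le> \<bar>\<theta>' x\<bar>"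
    and conv: "\<And>x. x \<in> {a..b} \<Longrightarrow> 0 \<le> \<theta>'' x"
  shows "\<bar>integral {a..b} (\<lambda>x. sin (\<theta> x))\<bar> \<le> 4 / \<mu>"
proof -
  have nz: "\<theta>' x \<noteq> 0" if "x \<in> {a..b}" for x
    using low[OF that] mu by auto
  have bnd: "\<bar>1 / \<theta>' x\<bar> \<le> 1 / \<mu>" if "x \<in> {a..b}" for x
    using low[OF that] mu by (simp add: abs_divide divide_simps)
  have G: "((\<lambda>x. sin (\<theta> x) + cos (\<theta> x) * (\<theta>'' x / (\<theta>' x)\<^sup>2))
              has_integral (- cos (\<theta> b) / \<theta>' b - - cos (\<theta> a) / \<theta>' a)) {a..b}"
  proof (rule fundamental_theorem_of_calculus[OF ab])
    fix x assume x: "x \<in> {a..b}"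
    have "((\<lambda>x. - cos (\<theta> x) / \<theta>' x) has_real_derivative
             sin (\<theta> x) + cos (\<theta> x) * (\<theta>'' x / (\<theta>' x)\<^sup>2)) (at x within {a..b})"
      using nz[OF x]
      by (auto intro!: derivative_eq_intros d1[OF x] d2[OF x] simp: field_simps power2_eq_square)
    thus "((\<lambda>x. - cos (\<theta> x) / \<theta>' x) has_vector_derivative
             sin (\<theta> x) + cos (\<theta> x) * (\<theta>'' x / (\<theta>' x)\<^sup>2)) (at x within {a..b})"
      by (simp add: has_real_derivative_iff_has_vector_derivative)
  qed
  have Q: "((\<lambda>x. \<theta>'' x / (\<theta>' x)\<^sup>2) has_integral (- 1 / \<theta>' b - - 1 / \<theta>' a)) {a..b}"
  proof (rule fundamental_theorem_of_calculus[OF ab])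
    fix x assume x: "x \<in> {a..b}"
    have "((\<lambda>x. - 1 / \<theta>' x) has_real_derivative \<theta>'' x / (\<theta>' x)\<^sup>2) (at x within {a..b})"
      using nz[OF x]
      by (auto intro!: derivative_eq_intros d2[OF x] simp: field_simps power2_eq_square)
    thus "((\<lambda>x. - 1 / \<theta>' x) has_vector_derivative \<theta>'' x / (\<theta>' x)\<^sup>2) (at x within {a..b})"
      by (simp add: has_real_derivative_iff_has_vector_derivative)
  qed
  have contsin: "continuous_on {a..b} (\<lambda>x. sin (\<theta> x))"
    using d1 by (intro continuous_intros) (metis DERIV_continuous_on)
  have S: "(\<lambda>x. sin (\<theta> x)) integrable_on {a..b}"
    by (rule integrable_continuous_interval[OF contsin])
  have R: "((\<lambda>x. cos (\<theta> x) * (\<theta>'' x / (\<theta>' x)\<^sup>2)) has_integral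
         ((- cos (\<theta> b) / \<theta>' b - - cos (\<theta> a) / \<theta>' a) - integral {a..b} (\<lambda>x. sin (\<theta> x)))) {a..b}"
    using has_integral_diff[OF G integrable_integral[OF S]] by simp
  have "norm (integral {a..b} (\<lambda>x. cos (\<theta> x) * (\<theta>'' x / (\<theta>' x)\<^sup>2)))
          \<le> integral {a..b} (\<lambda>x. \<theta>'' x / (\<theta>' x)\<^sup>2)"
  proof (intro integral_norm_bound_integral)
    show "norm (cos (\<theta> x) * (\<theta>'' x / (\<theta>' x)\<^sup>2)) \<le> \<theta>'' x / (\<theta>' x)\<^sup>2" if "x \<in> {a..b}" for x
      using mult_right_mono[OF abs_cos_le_one[of "\<theta> x"], of "\<theta>'' x / (\<theta>' x)\<^sup>2"] conv[OF that]
      by (simp add: abs_mult)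
  qed (use R Q in blast)+
  hence "\<bar>(- cos (\<theta> b) / \<theta>' b - - cos (\<theta> a) / \<theta>' a) - integral {a..b} (\<lambda>x. sin (\<theta> x))\<bar>
          \<le> - 1 / \<theta>' b - - 1 / \<theta>' a"
    by (simp only: integral_unique[OF R] integral_unique[OF Q] real_norm_def)
  moreover have "\<bar>cos (\<theta> x) / \<theta>' x\<bar> \<le> 1 / \<mu>" if "x \<in> {a..b}" for x
  proof -
    have "\<bar>cos (\<theta> x) / \<theta>' x\<bar> = \<bar>cos (\<theta> x)\<bar> * \<bar>1 / \<theta>' x\<bar>" by (simp add: abs_divide)
    also have "\<dots> \<le> 1 * (1 / \<mu>)" by (intro mult_mono bnd that) auto
    finally show ?thesis by simp
  qed
  from this[of a] this[of b] have "\<bar>cos (\<theta> a) / \<theta>' a\<bar> \<le> 1 / \<mu>" "\<bar>cos (\<theta> b) / \<theta>' b\<bar> \<le> 1 / \<mu>"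
    using ab by auto
  moreover have "\<bar>1 / \<theta>' a\<bar> \<le> 1 / \<mu>" "\<bar>1 / \<theta>' b\<bar> \<le> 1 / \<mu>"
    using bnd ab by auto
  moreover have "4 / \<mu> = 4 * (1 / \<mu>)" by simp
  ultimately show ?thesis by (simp only: minus_divide_left[symmetric])
qed

text \<open>
  The interval of length \<open>1 / sqrt \<kappa>\<close> next to \<open>a\<close> is estimated trivially; beyond it convexity forces
  \<open>\<theta>' \<ge> sqrt \<kappa>\<close>, and the first derivative test applies.
\<close>

lemma oscillatory_integral_second_derivative_right:
  fixes \<theta> \<theta>' \<theta>'' :: "real \<Rightarrow> real"
  assumes ab: "a \<le> b" and l: "\<kappa> > 0" and pos: "0 \<le> \<theta>' a"
    and d1: "\<And>x. x \<in> {a..b} \<Longrightarrow> (\<theta> has_real_derivative \<theta>' x) (at x within {a..b})"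
    and d2: "\<And>x. x \<in> {a..b} \<Longrightarrow> (\<theta>' has_real_derivative \<theta>'' x) (at x within {a..b})"
    and conv: "\<And>x. x \<in> {a..b} \<Longrightarrow> \<kappa> \<le> \<theta>'' x"
  shows "\<bar>integral {a..b} (\<lambda>x. sin (\<theta> x))\<bar> \<le> 5 / sqrt \<kappa>"
proof -
  define d where "d = 1 / sqrt \<kappa>"
  have d: "d > 0" "\<kappa> * d = sqrt \<kappa>"
    using l by (auto simp: d_def real_div_sqrt)
  have cont: "continuous_on {a..b} (\<lambda>x. sin (\<theta> x))"
    using d1 by (intro continuous_intros) (metis DERIV_continuous_on)
  define c where "c = min b (a + d)"
  have c: "a \<le> c" "c \<le> b" "c - a \<le> d" using ab d by (auto simp: c_def)
  have "norm (integral {a..c} (\<lambda>x. sin (\<theta> x))) \<le> 1 * (c - a)"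
    using c by (intro integral_bound) (auto intro: continuous_on_subset[OF cont])
  hence 1: "\<bar>integral {a..c} (\<lambda>x. sin (\<theta> x))\<bar> \<le> d" using c by simp
  have 2: "\<bar>integral {c..b} (\<lambda>x. sin (\<theta> x))\<bar> \<le> 4 / sqrt \<kappa>"
  proof (cases "c = b")
    case True
    thus ?thesis using l by simp
  next
    case False
    hence ceq: "c = a + d" by (auto simp: c_def min_def split: if_splits)
    show ?thesis
    proof (rule oscillatory_integral_first_derivative[where \<theta>' = \<theta>' and \<theta>'' = \<theta>''])
      fix x assume x: "x \<in> {c..b}"
      hence xa: "x \<in> {a..b}" using c by auto
      show "(\<theta> has_real_derivative \<theta>' x) (at x within {c..b})"
        by (rule DERIV_subset[OF d1[OF xa]]) (use c in auto)
      show "(\<theta>' has_real_derivative \<theta>'' x) (at x within {c..b})"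
        by (rule DERIV_subset[OF d2[OF xa]]) (use c in auto)
      show "0 \<le> \<theta>'' x" using conv[OF xa] l by linarith
      have "\<theta>' a - \<kappa> * a \<le> \<theta>' x - \<kappa> * x"
      proof (rule DERIV_nonneg_imp_increasing_open[where f = "\<lambda>x. \<theta>' x - \<kappa> * x"])
        show "a \<le> x" using xa by simp
        show "continuous_on {a..x} (\<lambda>x. \<theta>' x - \<kappa> * x)"
          using xa by (intro continuous_intros continuous_on_subset[OF DERIV_continuous_on[OF d2]]) auto
        fix y assume y: "a < y" "y < x"
        hence "(\<theta>' has_real_derivative \<theta>'' y) (at y within {a..b})" "at y within {a..b} = at y"
          using d2[of y] xa by (auto intro!: at_within_interior)
        hence "((\<lambda>x. \<theta>' x - \<kappa> * x) has_real_derivative \<theta>'' y - \<kappa>) (at y)"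
          by (auto intro!: derivative_eq_intros)
        moreover have "\<theta>'' y - \<kappa> \<ge> 0" using conv[of y] y xa by auto
        ultimately show "\<exists>z. ((\<lambda>x. \<theta>' x - \<kappa> * x) has_real_derivative z) (at y) \<and> 0 \<le> z" by blast
      qed
      moreover have "\<kappa> * d \<le> \<kappa> * (x - a)" using x ceq l by (intro mult_left_mono) auto
      ultimately show "sqrt \<kappa> \<le> \<bar>\<theta>' x\<bar>" using pos d by (simp add: right_diff_distrib)
    qed (use c l in auto)
  qed
  have "integral {a..b} (\<lambda>x. sin (\<theta> x)) =
      integral {a..c} (\<lambda>x. sin (\<theta> x)) + integral {c..b} (\<lambda>x. sin (\<theta> x))"
    using c cont by (intro Henstock_Kurzweil_Integration.integral_combine[symmetric] integrable_continuous_interval) auto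
  with 1 2 show ?thesis by (simp add: d_def field_simps)
qed

text \<open>
  The increasing function \<open>\<theta>'\<close> changes sign at most once; the interval is split there, and the left
  part is reflected.
\<close>

lemma oscillatory_integral_second_derivative:
  fixes \<theta> \<theta>' \<theta>'' :: "real \<Rightarrow> real"
  assumes ab: "a \<le> b" and l: "\<kappa> > 0"
    and d1: "\<And>x. x \<in> {a..b} \<Longrightarrow> (\<theta> has_real_derivative \<theta>' x) (at x within {a..b})"
    and d2: "\<And>x. x \<in> {a..b} \<Longrightarrow> (\<theta>' has_real_derivative \<theta>'' x) (at x within {a..b})"
    and conv: "\<And>x. x \<in> {a..b} \<Longrightarrow> \<kappa> \<le> \<theta>'' x"
  shows "\<bar>integral {a..b} (\<lambda>x. sin (\<theta> x))\<bar> \<le> 10 / sqrt \<kappa>"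
proof -
  have cont: "continuous_on {a..b} (\<lambda>x. sin (\<theta> x))"
    using d1 by (intro continuous_intros) (metis DERIV_continuous_on)
  have right: "\<bar>integral {p..b} (\<lambda>x. sin (\<theta> x))\<bar> \<le> 5 / sqrt \<kappa>" if p: "p \<in> {a..b}" "0 \<le> \<theta>' p" for p
  proof (rule oscillatory_integral_second_derivative_right[where \<theta>' = \<theta>' and \<theta>'' = \<theta>''])
    fix x assume x: "x \<in> {p..b}"
    hence xa: "x \<in> {a..b}" using p by auto
    show "(\<theta> has_real_derivative \<theta>' x) (at x within {p..b})"
      by (rule DERIV_subset[OF d1[OF xa]]) (use p in auto)
    show "(\<theta>' has_real_derivative \<theta>'' x) (at x within {p..b})"
      by (rule DERIV_subset[OF d2[OF xa]]) (use p in auto)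
    show "\<kappa> \<le> \<theta>'' x" using conv[OF xa] .
  qed (use p l in auto)
  have left: "\<bar>integral {a..p} (\<lambda>x. sin (\<theta> x))\<bar> \<le> 5 / sqrt \<kappa>" if p: "p \<in> {a..b}" "\<theta>' p \<le> 0" for p
  proof -
    have "\<bar>integral {-p..-a} (\<lambda>x. sin (\<theta> (- x)))\<bar> \<le> 5 / sqrt \<kappa>"
    proof (rule oscillatory_integral_second_derivative_right[where \<theta>' = "\<lambda>x. - \<theta>' (- x)" and \<theta>'' = "\<lambda>x. \<theta>'' (- x)"])
      fix x assume x: "x \<in> {-p..-a}"
      hence xa: "- x \<in> {a..b}" using p by auto
      have img: "uminus ` {-p..-a} \<subseteq> {a..b}" using p by auto
      have m: "(uminus has_real_derivative - 1) (at x within {-p..-a})"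
        by (auto intro!: derivative_eq_intros)
      show "((\<lambda>x. \<theta> (- x)) has_real_derivative - \<theta>' (- x)) (at x within {-p..-a})"
        using DERIV_image_chain[OF DERIV_subset[OF d1[OF xa] img] m] by (simp add: o_def)
      show "((\<lambda>x. - \<theta>' (- x)) has_real_derivative \<theta>'' (- x)) (at x within {-p..-a})"
        using DERIV_minus[OF DERIV_image_chain[OF DERIV_subset[OF d2[OF xa] img] m]] by (simp add: o_def)
      show "\<kappa> \<le> \<theta>'' (- x)" using conv[OF xa] .
    qed (use p l in auto)
    thus ?thesis
      using Henstock_Kurzweil_Integration.integral_reflect_real[of p a "\<lambda>x. sin (\<theta> x)"] by simp
  qed
  \<comment> \<open>\<open>p\<close> is a zero of \<open>\<theta>'\<close>, or the endpoint nearest to where the sign would change\<close>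
  obtain p where p: "p \<in> {a..b}" "p = a \<or> \<theta>' p \<le> 0" "p = b \<or> 0 \<le> \<theta>' p"
  proof (cases "0 \<le> \<theta>' a")
    case True thus ?thesis using that[of a] ab by auto
  next
    case F: False
    show ?thesis
    proof (cases "\<theta>' b \<le> 0")
      case True thus ?thesis using that[of b] ab by auto
    next
      case False
      have "\<exists>x\<ge>a. x \<le> b \<and> \<theta>' x = 0"
        using F False ab by (intro IVT' DERIV_continuous_on[OF d2]) auto
      thus ?thesis using that by auto
    qed
  qed
  have "\<bar>integral {a..p} (\<lambda>x. sin (\<theta> x))\<bar> \<le> 5 / sqrt \<kappa>"
    using p left l by (cases "p = a") auto
  moreover have "\<bar>integral {p..b} (\<lambda>x. sin (\<theta> x))\<bar> \<le> 5 / sqrt \<kappa>"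
    using p right l by (cases "p = b") auto
  moreover have "integral {a..b} (\<lambda>x. sin (\<theta> x)) =
      integral {a..p} (\<lambda>x. sin (\<theta> x)) + integral {p..b} (\<lambda>x. sin (\<theta> x))"
    using p cont by (intro Henstock_Kurzweil_Integration.integral_combine[symmetric] integrable_continuous_interval) auto
  moreover have "10 / sqrt \<kappa> = 5 / sqrt \<kappa> + 5 / sqrt \<kappa>" by simp
  ultimately show ?thesis by linarith
qed

text \<open>
  A decreasing nonnegative amplitude costs only its initial value, by partial integration.
\<close>

lemma van_der_Corput_sin:
  fixes \<theta> \<theta>' \<theta>'' A A' :: "real \<Rightarrow> real"
  assumes ab: "a \<le> b" and l: "\<kappa> > 0"
    and d1: "\<And>x. x \<in> {a..b} \<Longrightarrow> (\<theta> has_real_derivative \<theta>' x) (at x within {a..b})"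
    and d2: "\<And>x. x \<in> {a..b} \<Longrightarrow> (\<theta>' has_real_derivative \<theta>'' x) (at x within {a..b})"
    and conv: "\<And>x. x \<in> {a..b} \<Longrightarrow> \<kappa> \<le> \<theta>'' x"
    and dA: "\<And>x. x \<in> {a..b} \<Longrightarrow> (A has_real_derivative A' x) (at x within {a..b})"
    and dec: "\<And>x. x \<in> {a..b} \<Longrightarrow> A' x \<le> 0"
    and nn: "0 \<le> A b"
  shows "\<bar>integral {a..b} (\<lambda>x. A x * sin (\<theta> x))\<bar> \<le> 10 * A a / sqrt \<kappa>"
proof -
  define S where "S = (\<lambda>x. integral {a..x} (\<lambda>x. sin (\<theta> x)))"
  have cont: "continuous_on {a..b} (\<lambda>x. sin (\<theta> x))"
    using d1 by (intro continuous_intros) (metis DERIV_continuous_on)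
  have dS: "(S has_real_derivative sin (\<theta> x)) (at x within {a..b})" if "x \<in> {a..b}" for x
    using integral_has_vector_derivative[OF cont that]
    by (simp add: S_def has_real_derivative_iff_has_vector_derivative)
  have bS: "\<bar>S x\<bar> \<le> 10 / sqrt \<kappa>" if x: "x \<in> {a..b}" for x
    unfolding S_def
  proof (rule oscillatory_integral_second_derivative[where \<theta>' = \<theta>' and \<theta>'' = \<theta>''])
    fix y assume y: "y \<in> {a..x}"
    hence ya: "y \<in> {a..b}" using x by auto
    show "(\<theta> has_real_derivative \<theta>' y) (at y within {a..x})"
      by (rule DERIV_subset[OF d1[OF ya]]) (use x in auto)
    show "(\<theta>' has_real_derivative \<theta>'' y) (at y within {a..x})"
      by (rule DERIV_subset[OF d2[OF ya]]) (use x in auto)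
    show "\<kappa> \<le> \<theta>'' y" using conv[OF ya] .
  qed (use x l in auto)
  have FA: "(A' has_integral (A b - A a)) {a..b}"
    by (rule fundamental_theorem_of_calculus[OF ab])
       (use dA in \<open>simp add: has_real_derivative_iff_has_vector_derivative\<close>)
  have "((\<lambda>x. A' x * S x + sin (\<theta> x) * A x) has_integral (A b * S b - A a * S a)) {a..b}"
  proof (rule fundamental_theorem_of_calculus[OF ab])
    fix x assume x: "x \<in> {a..b}"
    show "((\<lambda>x. A x * S x) has_vector_derivative A' x * S x + sin (\<theta> x) * A x) (at x within {a..b})"
      using DERIV_mult[OF dA[OF x] dS[OF x]]
      by (simp add: has_real_derivative_iff_has_vector_derivative)
  qed
  moreover have S0: "S a = 0" by (simp add: S_def)
  ultimately have F: "((\<lambda>x. A' x * S x + sin (\<theta> x) * A x) has_integral (A b * S b)) {a..b}" by simp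
  have contA: "continuous_on {a..b} A" by (rule DERIV_continuous_on[OF dA])
  have i: "(\<lambda>x. A x * sin (\<theta> x)) integrable_on {a..b}"
    by (intro integrable_continuous_interval continuous_intros contA cont)
  have R: "((\<lambda>x. A' x * S x) has_integral (A b * S b - integral {a..b} (\<lambda>x. A x * sin (\<theta> x)))) {a..b}"
    using has_integral_diff[OF F integrable_integral[OF i]] by (simp add: mult.commute)
  have "norm (integral {a..b} (\<lambda>x. A' x * S x)) \<le> integral {a..b} (\<lambda>x. - (A' x) * (10 / sqrt \<kappa>))"
  proof (intro integral_norm_bound_integral)
    show "(\<lambda>x. - A' x * (10 / sqrt \<kappa>)) integrable_on {a..b}"
      using FA by (intro integrable_on_mult_left integrable_neg) auto
    show "norm (A' x * S x) \<le> - A' x * (10 / sqrt \<kappa>)" if "x \<in> {a..b}" for x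
      using dec[OF that] bS[OF that] mult_left_mono[OF bS[OF that], of "- A' x"] by (simp add: abs_mult)
  qed (use R in blast)
  also have "integral {a..b} (\<lambda>x. - (A' x) * (10 / sqrt \<kappa>)) = - (A b - A a) * (10 / sqrt \<kappa>)"
    by (rule integral_unique[OF has_integral_mult_left[OF has_integral_neg[OF FA]]])
  finally have "\<bar>A b * S b - integral {a..b} (\<lambda>x. A x * sin (\<theta> x))\<bar> \<le> (A a - A b) * (10 / sqrt \<kappa>)"
    by (simp add: integral_unique[OF R])
  moreover have "\<bar>A b * S b\<bar> \<le> A b * (10 / sqrt \<kappa>)"
    using mult_left_mono[OF bS nn] ab nn by (simp add: abs_mult)
  ultimately have "\<bar>integral {a..b} (\<lambda>x. A x * sin (\<theta> x))\<bar> \<le> (A a - A b) * (10 / sqrt \<kappa>) + A b * (10 / sqrt \<kappa>)"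
    by linarith
  also have "\<dots> = 10 * A a / sqrt \<kappa>" by (simp add: algebra_simps diff_divide_distrib)
  finally show ?thesis .
qed

section \<open>The Dirichlet kernel on a compact interval\<close>

lemma continuous_on_Icc_abs_bounded:
  fixes f :: "real \<Rightarrow> real"
  assumes "continuous_on {a..b} f"
  shows "\<exists>M. \<forall>x\<in>{a..b}. \<bar>f x\<bar> \<le> M"
  using compact_imp_bounded[OF compact_continuous_image[OF assms compact_Icc]]
  unfolding bounded_iff by auto

text \<open>
  The Riemann--Lebesgue lemma for continuous functions: a uniform polynomial approximation reduces it
  to an integration by parts.
\<close>

lemma Riemann_Lebesgue_continuous:
  fixes q :: "real \<Rightarrow> real"
  assumes q: "continuous_on {a..b} q" and ab: "a \<le> b"
  shows "((\<lambda>N. integral {a..b} (\<lambda>v. q v * sin (N * (v - u)))) \<longlongrightarrow> 0) at_top"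
proof (rule tendstoI)
  fix e :: real assume e: "0 < e"
  define d where "d = e / (2 * (b - a + 1))"
  have d: "d > 0" "d * (b - a) \<le> e / 2"
    using e ab by (auto simp: d_def field_simps)
  obtain g where g: "real_polynomial_function g" "\<And>x. x \<in> {a..b} \<Longrightarrow> \<bar>q x - g x\<bar> < d"
    using Stone_Weierstrass_real_polynomial_function[OF compact_Icc q d(1)] by blast
  obtain g' where g': "real_polynomial_function g'" "\<And>x. (g has_real_derivative g' x) (at x)"
    using has_real_derivative_polynomial_function[OF g(1)] by blast
  have cg: "continuous_on {a..b} g" "continuous_on {a..b} g'"
    using g(1) g'(1) continuous_on_polymonial_function
    by (auto simp: real_polynomial_function_eq)
  obtain M where M: "\<And>x. x \<in> {a..b} \<Longrightarrow> \<bar>g x\<bar> \<le> M"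
    using continuous_on_Icc_abs_bounded[OF cg(1)] by blast
  obtain M' where M': "\<And>x. x \<in> {a..b} \<Longrightarrow> \<bar>g' x\<bar> \<le> M'"
    using continuous_on_Icc_abs_bounded[OF cg(2)] by blast
  define C where "C = 2 * M + M' * (b - a)"
  have est: "\<bar>integral {a..b} (\<lambda>v. q v * sin (N * (v - u)))\<bar> \<le> e / 2 + C / N" if N: "N > 0" for N
  proof -
    have P: "((\<lambda>v. g v * sin (N * (v - u)) - g' v * cos (N * (v - u)) / N) has_integral
        (- (g b * cos (N * (b - u)) / N) - - (g a * cos (N * (a - u)) / N))) {a..b}"
    proof (rule fundamental_theorem_of_calculus[OF ab])
      fix x assume "x \<in> {a..b}"
      have "((\<lambda>v. - (g v * cos (N * (v - u)) / N)) has_real_derivative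
              g x * sin (N * (x - u)) - g' x * cos (N * (x - u)) / N) (at x within {a..b})"
        using N by (auto intro!: derivative_eq_intros DERIV_subset[OF g'(2)] simp: field_simps)
      thus "((\<lambda>v. - (g v * cos (N * (v - u)) / N)) has_vector_derivative
              g x * sin (N * (x - u)) - g' x * cos (N * (x - u)) / N) (at x within {a..b})"
        by (simp add: has_real_derivative_iff_has_vector_derivative)
    qed
    have i: "(\<lambda>v. g v * sin (N * (v - u))) integrable_on {a..b}"
            "(\<lambda>v. g' v * cos (N * (v - u)) / N) integrable_on {a..b}"
            "(\<lambda>v. q v * sin (N * (v - u))) integrable_on {a..b}"
            "(\<lambda>v. (q v - g v) * sin (N * (v - u))) integrable_on {a..b}"
      using N by (auto intro!: integrable_continuous_interval continuous_intros cg q)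
    have I': "norm (integral {a..b} (\<lambda>v. g' v * cos (N * (v - u)) / N)) \<le> M' / N * (b - a)"
    proof (intro integral_bound[OF ab])
      show "norm (g' v * cos (N * (v - u)) / N) \<le> M' / N" if "v \<in> {a..b}" for v
        using mult_mono[OF M'[OF that] abs_cos_le_one[of "N * (v - u)"]] M'[OF that] N
        by (simp add: abs_mult divide_right_mono)
    qed (use N in \<open>auto intro!: continuous_intros cg\<close>)
    have I: "integral {a..b} (\<lambda>v. g v * sin (N * (v - u))) =
        - (g b * cos (N * (b - u)) / N) + (g a * cos (N * (a - u)) / N)
         + integral {a..b} (\<lambda>v. g' v * cos (N * (v - u)) / N)"
      using integral_unique[OF P] Henstock_Kurzweil_Integration.integral_diff[OF i(1,2)] by simp
    have bd: "\<bar>g v * cos (N * (v - u)) / N\<bar> \<le> M / N" if "v \<in> {a..b}" for v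
      using mult_mono[OF M[OF that] abs_cos_le_one[of "N * (v - u)"]] M[OF that] N
      by (simp add: abs_mult divide_right_mono)
    note bda = bd[of a, unfolded atLeastAtMost_iff, OF conjI[OF order_refl ab]]
    note bdb = bd[of b, unfolded atLeastAtMost_iff, OF conjI[OF ab order_refl]]
    have "C / N = M / N + M / N + M' / N * (b - a)"
      by (simp add: C_def add_divide_distrib)
    with I I' have 1: "\<bar>integral {a..b} (\<lambda>v. g v * sin (N * (v - u)))\<bar> \<le> C / N"
      using bda bdb unfolding real_norm_def by linarith
    have "norm (integral {a..b} (\<lambda>v. (q v - g v) * sin (N * (v - u)))) \<le> d * (b - a)"
    proof (intro integral_bound[OF ab])
      show "norm ((q v - g v) * sin (N * (v - u))) \<le> d" if "v \<in> {a..b}" for v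
        using mult_mono[OF less_imp_le[OF g(2)[OF that]] abs_sin_le_one[of "N * (v - u)"]] d
        by (simp add: abs_mult)
    qed (use N in \<open>auto intro!: continuous_intros cg q\<close>)
    moreover have "integral {a..b} (\<lambda>v. q v * sin (N * (v - u))) =
       integral {a..b} (\<lambda>v. (q v - g v) * sin (N * (v - u))) + integral {a..b} (\<lambda>v. g v * sin (N * (v - u)))"
      by (subst Henstock_Kurzweil_Integration.integral_add[OF i(4,1), symmetric]) (simp add: algebra_simps)
    ultimately show ?thesis using 1 d(2) by (simp only: real_norm_def)
  qed
  have "((\<lambda>N. C / N) \<longlongrightarrow> 0) at_top"
    by (rule tendsto_divide_0[OF tendsto_const filterlim_at_top_imp_at_infinity[OF filterlim_ident]])
  hence "eventually (\<lambda>N. \<bar>C / N\<bar> < e / 2) at_top"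
    using e by (auto dest!: tendstoD[of _ 0 at_top "e / 2"])
  thus "eventually (\<lambda>N. dist (integral {a..b} (\<lambda>v. q v * sin (N * (v - u)))) 0 < e) at_top"
    using eventually_gt_at_top[of 0]
  proof eventually_elim
    case (elim N)
    show ?case unfolding dist_real_def using est[OF elim(2)] elim(1) by linarith
  qed
qed

text \<open>
  The continuous Dirichlet kernel \<open>sin (N x) / x = \<integral>\<^sub>0\<^sup>N cos (\<tau> x) d\<tau>\<close>, with its limit value \<open>N\<close> at
  \<open>x = 0\<close>.
\<close>

definition dirichlet_kernel :: "real \<Rightarrow> real \<Rightarrow> real" where
  "dirichlet_kernel N x = (if x = 0 then N else sin (N * x) / x)"

lemma dirichlet_kernel_sinc: "dirichlet_kernel N x = N * sinc (N * x)"
  by (auto simp: dirichlet_kernel_def)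

lemma dirichlet_kernel_minus: "dirichlet_kernel N (- x) = dirichlet_kernel N x"
  by (auto simp: dirichlet_kernel_def)

lemma continuous_on_dirichlet_kernel [continuous_intros]:
  "continuous_on S f \<Longrightarrow> continuous_on S (\<lambda>x. dirichlet_kernel N (f x))"
  unfolding dirichlet_kernel_sinc by (intro continuous_intros)

lemma borel_measurable_dirichlet_kernel [measurable]: "dirichlet_kernel N \<in> borel_measurable borel"
  by (intro borel_measurable_continuous_onI continuous_intros)

lemma integral_cos_eq_dirichlet_kernel:
  assumes "N \<ge> 0"
  shows "integral {0..N} (\<lambda>\<tau>. cos (\<tau> * x)) = dirichlet_kernel N x"
proof (cases "x = 0")
  case True
  thus ?thesis using assms by (simp add: dirichlet_kernel_def)
next
  case False
  have "((\<lambda>\<tau>. cos (\<tau> * x)) has_integral (sin (N * x) / x - sin (0 * x) / x)) {0..N}"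
  proof (rule fundamental_theorem_of_calculus[OF assms])
    fix t assume "t \<in> {0..N}"
    have "((\<lambda>t. sin (t * x) / x) has_real_derivative cos (t * x)) (at t within {0..N})"
      using False by (auto intro!: derivative_eq_intros)
    thus "((\<lambda>t. sin (t * x) / x) has_vector_derivative cos (t * x)) (at t within {0..N})"
      by (simp add: has_real_derivative_iff_has_vector_derivative)
  qed
  thus ?thesis using False by (simp add: dirichlet_kernel_def integral_unique)
qed

lemma abs_dirichlet_kernel_le:
  assumes "N \<ge> 0" shows "\<bar>dirichlet_kernel N x\<bar> \<le> N"
proof -
  have "norm (integral {0..N} (\<lambda>\<tau>. cos (\<tau> * x))) \<le> 1 * (N - 0)"
    by (rule integral_bound) (use assms in \<open>auto intro!: continuous_intros\<close>)
  thus ?thesis using assms by (simp add: integral_cos_eq_dirichlet_kernel)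
qed

lemma has_integral_dirichlet_kernel:
  assumes "N \<ge> 0" "\<bar>u\<bar> \<le> V"
  shows "((\<lambda>v. dirichlet_kernel N (v - u)) has_integral (Si (N * (V - u)) + Si (N * (V + u)))) {-V..V}"
proof -
  have "((\<lambda>v. dirichlet_kernel N (v - u)) has_integral (Si (N * (V - u)) - Si (N * (- V - u)))) {-V..V}"
  proof (rule fundamental_theorem_of_calculus)
    fix x assume "x \<in> {-V..V}"
    have "((\<lambda>v. Si (N * (v - u))) has_real_derivative dirichlet_kernel N (x - u)) (at x within {-V..V})"
    proof -
      have "((\<lambda>v. N * (v - u)) has_real_derivative N) (at x within {-V..V})"
        by (auto intro!: derivative_eq_intros)
      from DERIV_chain2[OF DERIV_Si this] show ?thesis
        by (simp only: dirichlet_kernel_sinc mult.commute)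
    qed
    thus "((\<lambda>v. Si (N * (v - u))) has_vector_derivative dirichlet_kernel N (x - u)) (at x within {-V..V})"
      by (simp add: has_real_derivative_iff_has_vector_derivative)
  qed (use assms in auto)
  moreover have "Si (N * (- V - u)) = - Si (N * (V + u))"
  proof -
    have "N * (- V - u) = - (N * (V + u))" by (simp add: algebra_simps)
    moreover have "N * (V + u) \<ge> 0" using assms by auto
    ultimately show ?thesis using Si_neg by simp
  qed
  ultimately show ?thesis by simp
qed

text \<open>
  Subtracting \<open>f u\<close> leaves the continuous difference quotient \<open>q\<close>, against which the kernel is the
  pure oscillation \<open>sin (N (v - u))\<close>; the subtracted part is a sine integral.
\<close>

lemma dirichlet_kernel_split:
  fixes f :: "real \<Rightarrow> real"
  assumes f: "\<And>v. (f has_real_derivative f' v) (at v)"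
    and N: "N \<ge> 0" and u: "\<bar>u\<bar> \<le> V"
  defines "q \<equiv> \<lambda>v. if v = u then f' u else (f v - f u) / (v - u)"
  shows "continuous_on UNIV q"
    and "integral {-V..V} (\<lambda>v. f v * dirichlet_kernel N (v - u)) =
           f u * (Si (N * (V - u)) + Si (N * (V + u))) + integral {-V..V} (\<lambda>v. q v * sin (N * (v - u)))"
proof -
  have "isCont q v" for v
  proof (cases "v = u")
    case True
    have "((\<lambda>v. (f v - f u) / (v - u)) \<longlongrightarrow> f' u) (at u)"
      using f[of u] by (simp add: has_field_derivative_iff)
    hence "(q \<longlongrightarrow> f' u) (at u)"
      by (rule Lim_transform_eventually) (auto simp: q_def eventually_at_filter)
    thus ?thesis using True by (simp add: isCont_def q_def)
  next
    case False
    have "isCont (\<lambda>v. (f v - f u) / (v - u)) v"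
      using False f DERIV_isCont by (intro continuous_intros) auto
    moreover have "eventually (\<lambda>x. x \<noteq> u) (nhds v)"
      using False by (rule t1_space_nhds)
    hence "eventually (\<lambda>x. q x = (f x - f u) / (x - u)) (nhds v)"
      by eventually_elim (simp add: q_def)
    ultimately show ?thesis by (subst isCont_cong)
  qed
  thus q: "continuous_on UNIV q" by (simp add: continuous_at_imp_continuous_on)
  have "f v * dirichlet_kernel N (v - u) = f u * dirichlet_kernel N (v - u) + q v * sin (N * (v - u))" for v
    by (cases "v = u") (auto simp: dirichlet_kernel_def q_def diff_divide_distrib left_diff_distrib)
  hence "integral {-V..V} (\<lambda>v. f v * dirichlet_kernel N (v - u)) =
     integral {-V..V} (\<lambda>v. f u * dirichlet_kernel N (v - u) + q v * sin (N * (v - u)))" by simp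
  also have "\<dots> = integral {-V..V} (\<lambda>v. f u * dirichlet_kernel N (v - u)) + integral {-V..V} (\<lambda>v. q v * sin (N * (v - u)))"
    by (intro Henstock_Kurzweil_Integration.integral_add integrable_continuous_interval continuous_intros
          continuous_on_subset[OF q]) auto
  also have "integral {-V..V} (\<lambda>v. f u * dirichlet_kernel N (v - u)) = f u * (Si (N * (V - u)) + Si (N * (V + u)))"
    by (rule integral_unique[OF has_integral_mult_right[OF has_integral_dirichlet_kernel[OF N u]]])
  finally show "integral {-V..V} (\<lambda>v. f v * dirichlet_kernel N (v - u)) =
           f u * (Si (N * (V - u)) + Si (N * (V + u))) + integral {-V..V} (\<lambda>v. q v * sin (N * (v - u)))" .
qed

lemma dirichlet_kernel_tendsto:
  fixes f :: "real \<Rightarrow> real"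
  assumes f: "\<And>v. (f has_real_derivative f' v) (at v)" and u: "\<bar>u\<bar> < V"
  shows "((\<lambda>N. integral {-V..V} (\<lambda>v. f v * dirichlet_kernel N (v - u))) \<longlongrightarrow> pi * f u) at_top"
proof -
  define q where "q = (\<lambda>v. if v = u then f' u else (f v - f u) / (v - u))"
  have c: "continuous_on UNIV q"
    using dirichlet_kernel_split(1)[OF f, of 0 u V] u by (simp add: q_def)
  have "((\<lambda>N. integral {-V..V} (\<lambda>v. q v * sin (N * (v - u)))) \<longlongrightarrow> 0) at_top"
    by (rule Riemann_Lebesgue_continuous) (use u c continuous_on_subset in auto)
  moreover have S: "((\<lambda>N. Si (N * c)) \<longlongrightarrow> pi / 2) at_top" if "c > 0" for c
    by (rule filterlim_compose[OF Si_at_top])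
       (use that in \<open>auto intro!: filterlim_at_top_mult_tendsto_pos[OF tendsto_const] filterlim_ident simp: mult.commute\<close>)
  ultimately have "((\<lambda>N. f u * (Si (N * (V - u)) + Si (N * (V + u))) + integral {-V..V} (\<lambda>v. q v * sin (N * (v - u))))
     \<longlongrightarrow> f u * (pi / 2 + pi / 2) + 0) at_top"
    using u by (intro tendsto_intros S) auto
  hence "((\<lambda>N. f u * (Si (N * (V - u)) + Si (N * (V + u))) + integral {-V..V} (\<lambda>v. q v * sin (N * (v - u))))
     \<longlongrightarrow> pi * f u) at_top" by (simp add: mult.commute)
  moreover have "eventually (\<lambda>N. f u * (Si (N * (V - u)) + Si (N * (V + u))) + integral {-V..V} (\<lambda>v. q v * sin (N * (v - u))) 
      = integral {-V..V} (\<lambda>v. f v * dirichlet_kernel N (v - u))) at_top"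
    using eventually_ge_at_top[of 0]
    by eventually_elim (use dirichlet_kernel_split(2)[OF f, of _ u V] u in \<open>simp add: q_def\<close>)
  ultimately show ?thesis by (rule Lim_transform_eventually)
qed

text \<open>
  By the mean value theorem the difference quotient is bounded by the supremum of \<open>f'\<close>, so the bound
  is uniform in the centre \<open>u\<close> as well as in \<open>N\<close>.
\<close>

lemma dirichlet_kernel_bounded:
  fixes f :: "real \<Rightarrow> real"
  assumes f: "\<And>v. (f has_real_derivative f' v) (at v)" and f': "continuous_on UNIV f'"
  obtains B where "\<And>N u. N \<ge> 0 \<Longrightarrow> \<bar>u\<bar> \<le> V \<Longrightarrow>
      \<bar>integral {-V..V} (\<lambda>v. f v * dirichlet_kernel N (v - u))\<bar> \<le> B"
proof -
  have cf: "continuous_on {-V..V} f" using f by (meson DERIV_continuous_on DERIV_subset subset_UNIV)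
  obtain M where M: "\<And>x. x \<in> {-V..V} \<Longrightarrow> \<bar>f x\<bar> \<le> M"
    using continuous_on_Icc_abs_bounded[OF cf] by blast
  obtain M' where M': "\<And>x. x \<in> {-V..V} \<Longrightarrow> \<bar>f' x\<bar> \<le> M'"
    using continuous_on_Icc_abs_bounded[OF continuous_on_subset[OF f' subset_UNIV], of "-V" V] by blast
  obtain B0 where B0: "\<And>T. \<bar>Si T\<bar> \<le> B0" using bounded_Si by blast
  show ?thesis
  proof (rule that[of "M * (B0 + B0) + M' * (2 * V)"])
    fix N u :: real assume N: "N \<ge> 0" and u: "\<bar>u\<bar> \<le> V"
    hence uV: "u \<in> {-V..V}" by auto
    define q where "q = (\<lambda>v. if v = u then f' u else (f v - f u) / (v - u))"
    have c: "continuous_on UNIV q"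
      using dirichlet_kernel_split(1)[OF f N u] by (simp add: q_def)
    have qb: "\<bar>q v\<bar> \<le> M'" if v: "v \<in> {-V..V}" for v
    proof (cases "v = u")
      case False
      have "norm (f v - f u) \<le> M' * norm (v - u)"
        by (rule field_differentiable_bound[of "{-V..V}" f f'])
           (use v uV M' f DERIV_subset[of f _ _ UNIV] in auto)
      thus ?thesis using False by (simp add: q_def abs_divide divide_simps)
    qed (use M'[OF uV] in \<open>simp add: q_def\<close>)
    have "norm (integral {-V..V} (\<lambda>v. q v * sin (N * (v - u)))) \<le> M' * (V - (- V))"
    proof (intro integral_bound)
      show "norm (q v * sin (N * (v - u))) \<le> M'" if "v \<in> {-V..V}" for v
        using mult_mono[OF qb[OF that] abs_sin_le_one[of "N * (v - u)"]] qb[OF that]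
        by (simp add: abs_mult)
    qed (use u in \<open>auto intro!: continuous_intros continuous_on_subset[OF c]\<close>)
    moreover have "\<bar>f u * (Si (N * (V - u)) + Si (N * (V + u)))\<bar> \<le> M * (B0 + B0)"
      unfolding abs_mult
      using B0[of "N * (V - u)"] B0[of "N * (V + u)"] M[OF uV]
      by (intro mult_mono) auto
    ultimately show "\<bar>integral {-V..V} (\<lambda>v. f v * dirichlet_kernel N (v - u))\<bar> \<le> M * (B0 + B0) + M' * (2 * V)"
      unfolding dirichlet_kernel_split(2)[OF f N u] unfolding q_def by simp
  qed
qed

section \<open>Rotating the contour in the integral of the Macdonald function\<close>

lemma cosh_ge_quadratic: "(1 + v\<^sup>2) / 4 \<le> cosh (v::real)"
proof -
  have "1 + \<bar>v\<bar> + \<bar>v\<bar>\<^sup>2 / 2 \<le> exp \<bar>v\<bar>" by (rule exp_lower_Taylor_quadratic) simp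
  moreover have "exp \<bar>v\<bar> / 2 \<le> cosh v" by (cases "v \<ge> 0") (auto simp: cosh_field_def)
  ultimately show ?thesis by simp
qed

lemma integrable_exp_cosh:
  assumes c: "c > 0" shows "integrable lborel (\<lambda>v. exp (- (c * cosh (v::real))))"
proof (rule Bochner_Integration.integrable_bound)
  show "integrable lborel (\<lambda>v::real. 4 / c * inverse (1 + v\<^sup>2))"
    using integrable_inverse_1_plus_square by (simp add: set_integrable_def)
  show "(\<lambda>v. exp (- (c * cosh (v::real)))) \<in> borel_measurable lborel"
    by (simp, intro borel_measurable_continuous_onI continuous_intros)
  show "AE v::real in lborel. norm (exp (- (c * cosh v))) \<le> norm (4 / c * inverse (1 + v\<^sup>2))"
  proof (rule AE_I2)
    fix v :: real
    have p: "0 < 1 + v\<^sup>2" by (simp add: add_pos_nonneg)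
    have "c * ((1 + v\<^sup>2) / 4) \<le> c * cosh v" using cosh_ge_quadratic c by (intro mult_left_mono) auto
    also have "\<dots> \<le> exp (c * cosh v)" using exp_ge_add_one_self[of "c * cosh v"] by linarith
    finally have "exp (- (c * cosh v)) \<le> inverse (c * ((1 + v\<^sup>2) / 4))"
      unfolding exp_minus using c p by (intro le_imp_inverse_le) auto
    also have "\<dots> = 4 / c * inverse (1 + v\<^sup>2)" using c p by (simp add: field_simps)
    finally show "norm (exp (- (c * cosh v))) \<le> norm (4 / c * inverse (1 + v\<^sup>2))" using c p by simp
  qed
qed

lemma tendsto_integral_symmetric_Icc:
  fixes f :: "real \<Rightarrow> 'a::{banach, second_countable_topology}"
  assumes f: "integrable lborel f"
  shows "((\<lambda>R. LBINT v:{-R..R}. f v) \<longlongrightarrow> (LBINT v. f v)) at_top"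
  unfolding set_lebesgue_integral_def
proof (rule integral_dominated_convergence_at_top[where w = "\<lambda>v. norm (f v)"])
  show "AE v in lborel. ((\<lambda>R. indicat_real {- R..R} v *\<^sub>R f v) \<longlongrightarrow> f v) at_top"
  proof (rule AE_I2)
    fix v
    have "eventually (\<lambda>R. indicat_real {- R..R} v *\<^sub>R f v = f v) at_top"
      using eventually_ge_at_top[of "\<bar>v\<bar>"] by eventually_elim (auto simp: indicator_def)
    thus "((\<lambda>R. indicat_real {- R..R} v *\<^sub>R f v) \<longlongrightarrow> f v) at_top"
      by (rule tendsto_eventually)
  qed
  show "\<forall>\<^sub>F R in at_top. AE v in lborel. norm (indicat_real {- R..R} v *\<^sub>R f v) \<le> norm (f v)"
    by (auto simp: indicator_def)
qed (use f in \<open>auto intro: borel_measurable_integrable\<close>)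

text \<open>
  The entire integrand of \<open>2 K\<^bsub>i\<tau>\<^esub>(x) = \<integral> exp (- x cosh z + i \<tau> z) dz\<close>, taken over the real line.
\<close>

definition macdonald_integrand :: "real \<Rightarrow> real \<Rightarrow> complex \<Rightarrow> complex" where
  "macdonald_integrand x \<tau> z = exp (- (of_real x * cosh z) + \<i> * of_real \<tau> * z)"

lemma macdonald_integrand_Complex:
  "macdonald_integrand x \<tau> (Complex v b) =
     of_real (exp (- (x * cosh v * cos b) - \<tau> * b)) * cis (\<tau> * v - x * sinh v * sin b)"
  by (simp add: macdonald_integrand_def complex_eq_iff Re_exp Im_exp cosh_field_def sinh_field_def field_simps)

lemma macdonald_integrand_holomorphic: "macdonald_integrand x \<tau> holomorphic_on UNIV"
  unfolding macdonald_integrand_def[abs_def] cosh_field_def by (intro holomorphic_intros) auto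

lemma norm_macdonald_integrand:
  "norm (macdonald_integrand x \<tau> (Complex v b)) = exp (- (x * cosh v * cos b) - \<tau> * b)"
  by (simp add: macdonald_integrand_Complex norm_mult)

lemma continuous_macdonald_integrand:
  "continuous_on S (\<lambda>v. macdonald_integrand x \<tau> (Complex v b))"
  unfolding macdonald_integrand_Complex by (intro continuous_intros)

lemma integrable_macdonald_integrand:
  assumes x: "x > 0" and b: "cos b > 0"
  shows "integrable lborel (\<lambda>v. macdonald_integrand x \<tau> (Complex v b))"
proof (rule Bochner_Integration.integrable_bound)
  show "integrable lborel (\<lambda>v. exp (- \<tau> * b) * exp (- (x * cos b * cosh v)))"
    using x b by (intro integrable_mult_right integrable_exp_cosh) simp
  show "(\<lambda>v. macdonald_integrand x \<tau> (Complex v b)) \<in> borel_measurable lborel"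
    using borel_measurable_continuous_onI[OF continuous_macdonald_integrand] by simp
  show "AE v in lborel. norm (macdonald_integrand x \<tau> (Complex v b)) \<le> norm (exp (- \<tau> * b) * exp (- (x * cos b * cosh v)))"
    by (simp add: norm_macdonald_integrand exp_diff exp_minus field_simps flip: exp_add)
qed

text \<open>
  Moving the line of integration to height \<open>\<alpha>\<close>. A primitive \<open>G\<close> of the entire integrand replaces
  Cauchy's theorem on the rectangle: horizontal integrals are differences of \<open>G\<close>, and the vertical
  sides contribute at most \<open>\<alpha>\<close> times the supremum of the integrand there, which tends to \<open>0\<close>.
\<close>

lemma macdonald_integrand_shift:
  assumes x: "x > 0" and \<alpha>: "0 \<le> \<alpha>" "\<alpha> < pi / 2"
  shows "(LBINT v. macdonald_integrand x \<tau> (Complex v \<alpha>)) = (LBINT v. macdonald_integrand x \<tau> (Complex v 0))"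
proof -
  define F where "F = macdonald_integrand x \<tau>"
  obtain G where G: "\<And>z. (G has_field_derivative F z) (at z)"
    using holomorphic_convex_primitive'[OF convex_UNIV open_UNIV macdonald_integrand_holomorphic[of x \<tau>]]
    unfolding F_def by auto
  have ca: "cos \<alpha> > 0" using \<alpha> by (intro cos_gt_zero_pi) auto
  have hor: "(LBINT v:{-R..R}. F (Complex v b)) = G (Complex R b) - G (Complex (-R) b)" if "R \<ge> 0" for R b
  proof -
    have "set_integrable lborel {-R..R} (\<lambda>v. F (Complex v b))"
      unfolding F_def by (rule borel_integrable_atLeastAtMost'[OF continuous_macdonald_integrand])
    hence "(LBINT v:{-R..R}. F (Complex v b)) = integral {-R..R} (\<lambda>v. F (Complex v b))"
      by (rule set_borel_integral_eq_integral)
    also have "\<dots> = G (Complex R b) - G (Complex (-R) b)"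
    proof (rule integral_unique[OF fundamental_theorem_of_calculus])
      fix v assume "v \<in> {-R..R}"
      have "((\<lambda>v. Complex v b) has_vector_derivative 1) (at v within {-R..R})"
        unfolding Complex_eq by (auto intro!: derivative_eq_intros)
      from field_vector_diff_chain_within[OF this] G
      show "((\<lambda>v. G (Complex v b)) has_vector_derivative F (Complex v b)) (at v within {-R..R})"
        by (fastforce simp: o_def intro: has_field_derivative_at_within)
    qed (use that in auto)
    finally show ?thesis .
  qed
  define E where "E = (\<lambda>R. exp (\<bar>\<tau>\<bar> * \<alpha>) * exp (- (x * cos \<alpha> * cosh R)))"
  have vert: "norm (G (Complex R \<alpha>) - G (Complex R 0)) \<le> E R * \<alpha>" for R
  proof -
    have "norm (G (Complex R \<alpha>) - G (Complex R 0)) \<le> E R * norm (Complex R \<alpha> - Complex R 0)"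
    proof (rule field_differentiable_bound[where S = "closed_segment (Complex R \<alpha>) (Complex R 0)" and f' = F])
      fix z assume "z \<in> closed_segment (Complex R \<alpha>) (Complex R 0)"
      hence "\<exists>b. z = Complex R b \<and> 0 \<le> b \<and> b \<le> \<alpha>"
        using \<alpha> by (cases z) (auto simp: closed_segment_same_Re closed_segment_eq_real_ivl split: if_splits)
      then obtain b where b: "z = Complex R b" "0 \<le> b" "b \<le> \<alpha>" by blast
      have "x * cosh R * cos \<alpha> \<le> x * cosh R * cos b"
        using b \<alpha> x by (intro mult_left_mono cos_monotone_0_pi_le) auto
      moreover have "- \<tau> * b \<le> \<bar>\<tau>\<bar> * \<alpha>"
        using b by (intro mult_mono) auto
      ultimately show "norm (F z) \<le> E R"
        by (simp add: F_def b norm_macdonald_integrand E_def mult_ac flip: exp_add)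
    qed (auto intro: has_field_derivative_at_within[OF G])
    also have "norm (Complex R \<alpha> - Complex R 0) = \<alpha>" using \<alpha> by (simp add: cmod_def)
    finally show ?thesis .
  qed
  have "(E \<longlongrightarrow> 0) at_top"
    unfolding E_def using x ca by real_asymp
  hence "((\<lambda>R. E R * \<alpha> + E R * \<alpha>) \<longlongrightarrow> 0) at_top" by (auto intro!: tendsto_eq_intros)
  hence "((\<lambda>R. (LBINT v:{-R..R}. F (Complex v \<alpha>)) - (LBINT v:{-R..R}. F (Complex v 0))) \<longlongrightarrow> 0) at_top"
  proof (rule Lim_null_comparison[rotated])
    show "\<forall>\<^sub>F R in at_top. norm ((LBINT v:{-R..R}. F (Complex v \<alpha>)) - (LBINT v:{-R..R}. F (Complex v 0))) \<le> E R * \<alpha> + E R * \<alpha>"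
      using eventually_ge_at_top[of 0]
    proof eventually_elim
      case (elim R)
      have "(LBINT v:{-R..R}. F (Complex v \<alpha>)) - (LBINT v:{-R..R}. F (Complex v 0)) =
         (G (Complex R \<alpha>) - G (Complex R 0)) - (G (Complex (-R) \<alpha>) - G (Complex (-R) 0))"
        by (simp add: hor[OF elim])
      hence "norm ((LBINT v:{-R..R}. F (Complex v \<alpha>)) - (LBINT v:{-R..R}. F (Complex v 0))) \<le>
          norm (G (Complex R \<alpha>) - G (Complex R 0)) + norm (G (Complex (-R) \<alpha>) - G (Complex (-R) 0))"
        by (simp only: norm_triangle_ineq4)
      also have "\<dots> \<le> E R * \<alpha> + E (- R) * \<alpha>"
        by (intro add_mono vert)
      also have "E (- R) = E R" by (simp add: E_def)
      finally show ?case .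
    qed
  qed
  moreover have "((\<lambda>R. (LBINT v:{-R..R}. F (Complex v \<alpha>)) - (LBINT v:{-R..R}. F (Complex v 0)))
      \<longlongrightarrow> (LBINT v. F (Complex v \<alpha>)) - (LBINT v. F (Complex v 0))) at_top"
    unfolding F_def using x ca
    by (intro tendsto_diff tendsto_integral_symmetric_Icc integrable_macdonald_integrand) auto
  ultimately have "(LBINT v. F (Complex v \<alpha>)) - (LBINT v. F (Complex v 0)) = 0"
    using tendsto_unique[OF trivial_limit_at_top_linorder] by blast
  thus ?thesis by (simp add: F_def)
qed

text \<open>
  The real value of \<open>K\<^bsub>i\<tau>\<^esub>(x)\<close> for \<open>x > 0\<close>, written as half of the integral over the whole line.
\<close>

definition macdonald_im :: "real \<Rightarrow> real \<Rightarrow> real" where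
  "macdonald_im \<tau> x = (LBINT v. exp (- (x * cosh v)) * cos (\<tau> * v)) / 2"

text \<open>
  The real part of \<open>exp (- x cosh (v + i \<alpha>))\<close>; at \<open>\<alpha> = pi / 2\<close> it is \<open>cos (x sinh v)\<close>.
\<close>

definition rotated_exp_cosh :: "real \<Rightarrow> real \<Rightarrow> real \<Rightarrow> real" where
  "rotated_exp_cosh x \<alpha> v = exp (- (x * cosh v * cos \<alpha>)) * cos (x * sinh v * sin \<alpha>)"

lemma continuous_on_rotated_exp_cosh [continuous_intros]:
  fixes f g :: "real \<Rightarrow> real"
  shows "continuous_on S f \<Longrightarrow> continuous_on S g \<Longrightarrow> continuous_on S (\<lambda>v. rotated_exp_cosh x (f v) (g v))"
  unfolding rotated_exp_cosh_def by (intro continuous_intros)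

lemma borel_measurable_rotated_exp_cosh [measurable]: "rotated_exp_cosh x \<alpha> \<in> borel_measurable borel"
  by (intro borel_measurable_continuous_onI continuous_intros)

lemma abs_rotated_exp_cosh_le: "\<bar>rotated_exp_cosh x \<alpha> v\<bar> \<le> exp (- (x * cos \<alpha> * cosh v))"
  unfolding rotated_exp_cosh_def abs_mult
  using abs_cos_le_one[of "x * sinh v * sin \<alpha>"] by (simp add: mult_ac mult_right_le_one_le)

lemma integrable_rotated_exp_cosh:
  assumes "x > 0" "cos \<alpha> > 0"
  shows "integrable lborel (rotated_exp_cosh x \<alpha>)"
  by (rule Bochner_Integration.integrable_bound[OF integrable_exp_cosh[of "x * cos \<alpha>"]])
     (use assms abs_rotated_exp_cosh_le in auto)

text \<open>
  Taking real parts of the shifted integral for \<open>\<tau>\<close> and for \<open>- \<tau>\<close> and adding removes the sine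
  contribution \<open>k\<close> of the imaginary part of \<open>exp (- x cosh (v + i \<alpha>))\<close>.
\<close>

lemma rotated_exp_cosh_cosine_transform:
  assumes x: "x > 0" and \<alpha>: "0 \<le> \<alpha>" "\<alpha> < pi / 2"
  shows "(LBINT v. rotated_exp_cosh x \<alpha> v * cos (\<tau> * v)) = 2 * cosh (\<alpha> * \<tau>) * macdonald_im \<tau> x"
proof -
  have ca: "cos \<alpha> > 0" using \<alpha> by (intro cos_gt_zero_pi) auto
  define k where "k = (\<lambda>v. exp (- (x * cosh v * cos \<alpha>)) * sin (x * sinh v * sin \<alpha>))"
  define I where "I = (\<lambda>t. LBINT v. rotated_exp_cosh x \<alpha> v * cos (t * v) + k v * sin (t * v))"
  have Re_eq: "Re (macdonald_integrand x t (Complex v \<alpha>)) =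
      exp (- t * \<alpha>) * (rotated_exp_cosh x \<alpha> v * cos (t * v) + k v * sin (t * v))" for t v
  proof -
    have "exp (- (x * cosh v * cos \<alpha>) - t * \<alpha>) = exp (- t * \<alpha>) * exp (- (x * cosh v * cos \<alpha>))"
      by (simp flip: exp_add)
    thus ?thesis
      by (simp add: macdonald_integrand_Complex rotated_exp_cosh_def k_def cos_diff distrib_left mult_ac)
  qed
  have I: "I t = exp (\<alpha> * t) * (2 * macdonald_im t x)"
    and int: "integrable lborel (\<lambda>v. rotated_exp_cosh x \<alpha> v * cos (t * v) + k v * sin (t * v))" for t
  proof -
    have i: "integrable lborel (\<lambda>v. macdonald_integrand x t (Complex v \<alpha>))"
            "integrable lborel (\<lambda>v. macdonald_integrand x t (Complex v 0))"
      using x ca by (auto intro: integrable_macdonald_integrand)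
    from integrable_Re[OF i(1)]
    show "integrable lborel (\<lambda>v. rotated_exp_cosh x \<alpha> v * cos (t * v) + k v * sin (t * v))"
      unfolding Re_eq by simp
    have e1: "exp (\<alpha> * t) * exp (- t * \<alpha>) = 1" by (simp flip: exp_add)
    have "exp (- t * \<alpha>) * I t = (LBINT v. Re (macdonald_integrand x t (Complex v \<alpha>)))"
      by (simp add: Re_eq I_def)
    also have "\<dots> = Re (LBINT v. macdonald_integrand x t (Complex v \<alpha>))"
      by (rule integral_Re[OF i(1)])
    also have "\<dots> = Re (LBINT v. macdonald_integrand x t (Complex v 0))"
      by (simp only: macdonald_integrand_shift[OF x \<alpha>])
    also have "\<dots> = (LBINT v. Re (macdonald_integrand x t (Complex v 0)))"
      by (rule integral_Re[OF i(2), symmetric])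
    also have "\<dots> = 2 * macdonald_im t x"
      by (simp add: macdonald_integrand_Complex macdonald_im_def)
    finally have "exp (\<alpha> * t) * (exp (- t * \<alpha>) * I t) = exp (\<alpha> * t) * (2 * macdonald_im t x)" by simp
    thus "I t = exp (\<alpha> * t) * (2 * macdonald_im t x)"
      using e1 by (simp only: mult.assoc[symmetric] mult_1_left)
  qed
  have even: "macdonald_im (- \<tau>) x = macdonald_im \<tau> x" by (simp add: macdonald_im_def)
  have "I \<tau> + I (- \<tau>) = (LBINT v. (rotated_exp_cosh x \<alpha> v * cos (\<tau> * v) + k v * sin (\<tau> * v)) +
           (rotated_exp_cosh x \<alpha> v * cos (- \<tau> * v) + k v * sin (- \<tau> * v)))"
    unfolding I_def by (rule Bochner_Integration.integral_add[OF int int, symmetric])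
  also have "\<dots> = (LBINT v. 2 * (rotated_exp_cosh x \<alpha> v * cos (\<tau> * v)))"
    by (rule Bochner_Integration.integral_cong) auto
  also have "\<dots> = 2 * (LBINT v. rotated_exp_cosh x \<alpha> v * cos (\<tau> * v))" by simp
  finally show ?thesis by (simp add: I even cosh_field_def algebra_simps)
qed

section \<open>Truncated inversion of the cosine transform\<close>

lemma borel_measurable_cosh_real [measurable]: "(cosh :: real \<Rightarrow> real) \<in> borel_measurable borel"
  by (intro borel_measurable_continuous_onI continuous_intros)

lemma Fubini_bounded_kernel:
  fixes f g :: "real \<Rightarrow> real" and k :: "real \<Rightarrow> real \<Rightarrow> real"
  assumes f: "integrable lborel f" and g: "integrable lborel g"
    and k [measurable]: "(\<lambda>p. k (fst p) (snd p)) \<in> borel_measurable (borel \<Otimes>\<^sub>M borel)"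
    and B: "\<And>x y. \<bar>k x y\<bar> \<le> 1"
  shows "(LBINT x. LBINT y. f x * g y * k x y) = (LBINT y. LBINT x. f x * g y * k x y)"
proof -
  have [measurable]: "f \<in> borel_measurable borel" "g \<in> borel_measurable borel"
    using borel_measurable_integrable[OF f] borel_measurable_integrable[OF g] by auto
  have [measurable]: "k x \<in> borel_measurable borel" for x
    using measurable_compose[OF measurable_Pair1' k, of x] by (simp add: space_borel)
  have bound: "\<bar>f x * g y * k x y\<bar> \<le> \<bar>f x\<bar> * \<bar>g y\<bar>" for x y
    using B[of x y] by (simp add: abs_mult mult_left_le)
  have inner: "integrable lborel (\<lambda>y. f x * g y * k x y)" for x
  proof (rule Bochner_Integration.integrable_bound[of _ "\<lambda>y. f x * g y"])
    show "integrable lborel (\<lambda>y. f x * g y)" using g by simp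
    show "(\<lambda>y. f x * g y * k x y) \<in> borel_measurable lborel" by simp
  qed (use bound in \<open>simp add: abs_mult\<close>)
  have "integrable (lborel \<Otimes>\<^sub>M lborel) (\<lambda>(x, y). f x * g y * k x y)"
  proof (rule lborel_pair.Fubini_integrable)
    show "(\<lambda>(x, y). f x * g y * k x y) \<in> borel_measurable (lborel \<Otimes>\<^sub>M lborel)"
      by (simp add: case_prod_beta')
    show "integrable lborel (\<lambda>x. LBINT y. norm (case (x, y) of (x, y) \<Rightarrow> f x * g y * k x y))"
    proof (rule Bochner_Integration.integrable_bound[of _ "\<lambda>x. \<bar>f x\<bar> * (LBINT y. \<bar>g y\<bar>)"])
      show "integrable lborel (\<lambda>x. \<bar>f x\<bar> * (LBINT y. \<bar>g y\<bar>))" using f by simp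
      show "(\<lambda>x. LBINT y. norm (case (x, y) of (x, y) \<Rightarrow> f x * g y * k x y)) \<in> borel_measurable lborel"
        by (simp add: case_prod_beta')
      show "AE x in lborel. norm (LBINT y. norm (case (x, y) of (x, y) \<Rightarrow> f x * g y * k x y))
              \<le> norm (\<bar>f x\<bar> * (LBINT y. \<bar>g y\<bar>))"
      proof (rule AE_I2)
        fix x
        have "(LBINT y. \<bar>f x * g y * k x y\<bar>) \<le> (LBINT y. \<bar>f x\<bar> * \<bar>g y\<bar>)"
          using inner[of x] g bound by (intro integral_mono) auto
        moreover have "0 \<le> (LBINT y. \<bar>f x * g y * k x y\<bar>)" by simp
        ultimately show "norm (LBINT y. norm (case (x, y) of (x, y) \<Rightarrow> f x * g y * k x y))
              \<le> norm (\<bar>f x\<bar> * (LBINT y. \<bar>g y\<bar>))"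
          by simp
      qed
    qed
    show "AE x in lborel. integrable lborel (\<lambda>y. case (x, y) of (x, y) \<Rightarrow> f x * g y * k x y)"
      using inner by simp
  qed
  from lborel_pair.Fubini_integral[OF this] show ?thesis by simp
qed

lemma borel_measurable_macdonald_im [measurable]: "(\<lambda>\<tau>. macdonald_im \<tau> x) \<in> borel_measurable borel"
  unfolding macdonald_im_def by measurable

lemma abs_macdonald_im_le:
  assumes "x > 0" shows "\<bar>macdonald_im \<tau> x\<bar> \<le> macdonald_im 0 x"
proof -
  have i: "integrable lborel (\<lambda>v. exp (- (x * cosh v)))" by (rule integrable_exp_cosh[OF assms])
  have "\<bar>LBINT v. exp (- (x * cosh v)) * cos (\<tau> * v)\<bar> \<le> (LBINT v. \<bar>exp (- (x * cosh v)) * cos (\<tau> * v)\<bar>)"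
    by (rule integral_abs_bound)
  also have "\<dots> \<le> (LBINT v. exp (- (x * cosh v)))"
  proof (rule integral_mono)
    show "integrable lborel (\<lambda>v. \<bar>exp (- (x * cosh v)) * cos (\<tau> * v)\<bar>)"
      by (rule Bochner_Integration.integrable_bound[OF i]) (auto simp: abs_mult mult_left_le)
  qed (use i in \<open>auto simp: abs_mult mult_left_le\<close>)
  finally show ?thesis by (simp add: macdonald_im_def)
qed

lemma integrable_indicator_Icc: "integrable lborel (indicat_real {a..b::real})"
  by (rule integrable_real_indicator) (auto simp: emeasure_lborel_Icc_eq)

lemma set_integrable_bounded_Icc:
  fixes f :: "real \<Rightarrow> 'a::{banach, second_countable_topology}"
  assumes "f \<in> borel_measurable borel" and "\<And>t. t \<in> {a..b} \<Longrightarrow> norm (f t) \<le> B"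
  shows "set_integrable lborel {a..b} f"
  unfolding set_integrable_def
proof (rule Bochner_Integration.integrable_bound[of _ "\<lambda>t. indicat_real {a..b} t * B"])
  show "integrable lborel (\<lambda>t. indicat_real {a..b} t * B)"
    by (intro integrable_mult_left integrable_indicator_Icc)
  show "AE t in lborel. norm (indicat_real {a..b} t *\<^sub>R f t) \<le> norm (indicat_real {a..b} t * B)"
    using assms(2) by (intro AE_I2) (force simp: indicator_def)
qed (use assms in auto)

lemma borel_set_integral_eq_integral_Icc:
  fixes f :: "real \<Rightarrow> real"
  assumes "continuous_on {a..b} f"
  shows "(LBINT x:{a..b}. f x) = integral {a..b} f"
  by (rule set_borel_integral_eq_integral(2)[OF borel_integrable_atLeastAtMost'[OF assms]])

text \<open>
  The inverse cosine transform of \<open>cosh (\<alpha> \<tau>) K\<^bsub>i\<tau>\<^esub>(x)\<close>, cut off at \<open>\<tau> = N\<close> and without its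
  normalising factor.
\<close>

definition truncated_inverse :: "real \<Rightarrow> real \<Rightarrow> real \<Rightarrow> real \<Rightarrow> real" where
  "truncated_inverse \<alpha> x N u = (LBINT \<tau>:{0..N}. cosh (\<alpha> * \<tau>) * macdonald_im \<tau> x * cos (\<tau> * u))"

lemma cosh_le_of_abs_le: "\<bar>a\<bar> \<le> b \<Longrightarrow> cosh a \<le> cosh (b::real)"
  by (metis abs_ge_zero cosh_real_abs cosh_real_nonneg_le_iff order_trans)

lemma abs_cosh_macdonald_im_le:
  assumes x: "x > 0" and \<alpha>: "\<bar>\<alpha>\<bar> \<le> a" and t: "t \<in> {0..N}"
  shows "\<bar>cosh (\<alpha> * t) * macdonald_im t x\<bar> \<le> cosh (a * N) * macdonald_im 0 x"
proof -
  have "\<bar>\<alpha> * t\<bar> \<le> a * N" unfolding abs_mult using \<alpha> t by (intro mult_mono) auto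
  hence "cosh (\<alpha> * t) \<le> cosh (a * N)" by (rule cosh_le_of_abs_le)
  thus ?thesis unfolding abs_mult using abs_macdonald_im_le[OF x] by (intro mult_mono) auto
qed

lemma set_integrable_cosh_macdonald_im:
  assumes x: "x > 0"
  shows "set_integrable lborel {0..N} (\<lambda>\<tau>. cosh (\<alpha> * \<tau>) * macdonald_im \<tau> x)"
  by (rule set_integrable_bounded_Icc[where B = "cosh (\<bar>\<alpha>\<bar> * N) * macdonald_im 0 x"])
     (use abs_cosh_macdonald_im_le[OF x] in auto)

text \<open>
  Insert the cosine transform of the rotated kernel and interchange the integrals; as the kernel is
  even, the two terms of \<open>2 cos (\<tau> v) cos (\<tau> u) = cos (\<tau> (v - u)) + cos (\<tau> (v + u))\<close> contribute equally.
\<close>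

lemma truncated_inverse_eq_dirichlet:
  assumes x: "x > 0" and \<alpha>: "0 \<le> \<alpha>" "\<alpha> < pi / 2" and N: "N \<ge> 0"
  shows "truncated_inverse \<alpha> x N u = (LBINT v. rotated_exp_cosh x \<alpha> v * dirichlet_kernel N (v - u)) / 2"
    and "integrable lborel (\<lambda>v. rotated_exp_cosh x \<alpha> v * dirichlet_kernel N (v - u))"
proof -
  have ca: "cos \<alpha> > 0" using \<alpha> by (intro cos_gt_zero_pi) auto
  let ?h = "rotated_exp_cosh x \<alpha>"
  have h: "integrable lborel ?h" by (rule integrable_rotated_exp_cosh[OF x ca])
  have iD: "integrable lborel (\<lambda>v. ?h v * dirichlet_kernel N (v - u))" for u
  proof (rule Bochner_Integration.integrable_bound[of _ "\<lambda>v. N * ?h v"])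
    show "integrable lborel (\<lambda>v. N * ?h v)" using h by simp
    show "AE v in lborel. norm (?h v * dirichlet_kernel N (v - u)) \<le> norm (N * ?h v)"
      using mult_right_mono[OF abs_dirichlet_kernel_le[OF N] abs_ge_zero] N
      by (intro AE_I2) (simp add: abs_mult mult.commute[of "\<bar>?h _\<bar>"])
  qed simp
  show "integrable lborel (\<lambda>v. ?h v * dirichlet_kernel N (v - u))" by (rule iD)
  have inner: "(LBINT \<tau>. indicat_real {0..N} \<tau> * ?h v * (cos (\<tau> * v) * cos (\<tau> * u))) =
      (?h v * dirichlet_kernel N (v - u) + ?h v * dirichlet_kernel N (v + u)) / 2" for v
  proof -
    have c: "continuous_on {0..N} (\<lambda>\<tau>. cos (\<tau> * c))" for c :: real
      by (intro continuous_intros)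
    have "(LBINT \<tau>. indicat_real {0..N} \<tau> * ?h v * (cos (\<tau> * v) * cos (\<tau> * u))) =
       (LBINT \<tau>:{0..N}. ?h v * (cos (\<tau> * v) * cos (\<tau> * u)))"
      by (simp only: set_lebesgue_integral_def real_scaleR_def mult.assoc)
    also have "\<dots> = integral {0..N} (\<lambda>\<tau>. ?h v * (cos (\<tau> * v) * cos (\<tau> * u)))"
      by (intro borel_set_integral_eq_integral_Icc continuous_intros)
    also have "\<dots> = integral {0..N} (\<lambda>\<tau>. ?h v / 2 * cos (\<tau> * (v - u)) + ?h v / 2 * cos (\<tau> * (v + u)))"
      by (rule Henstock_Kurzweil_Integration.integral_cong)
         (simp add: cos_times_cos distrib_left right_diff_distrib add_divide_distrib)
    also have "\<dots> = integral {0..N} (\<lambda>\<tau>. ?h v / 2 * cos (\<tau> * (v - u))) + integral {0..N} (\<lambda>\<tau>. ?h v / 2 * cos (\<tau> * (v + u)))"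
      by (intro Henstock_Kurzweil_Integration.integral_add integrable_continuous_interval continuous_intros)
    also have "\<dots> = ?h v / 2 * dirichlet_kernel N (v - u) + ?h v / 2 * dirichlet_kernel N (v + u)"
      by (simp only: integral_mult_right integral_cos_eq_dirichlet_kernel[OF N])
    finally show ?thesis by (simp add: add_divide_distrib)
  qed
  have "truncated_inverse \<alpha> x N u =
      (LBINT \<tau>. (LBINT v. indicat_real {0..N} \<tau> * ?h v * (cos (\<tau> * v) * cos (\<tau> * u)))) / 2"
  proof -
    have "indicat_real {0..N} \<tau> * (cosh (\<alpha> * \<tau>) * macdonald_im \<tau> x * cos (\<tau> * u)) =
        (LBINT v. indicat_real {0..N} \<tau> * ?h v * (cos (\<tau> * v) * cos (\<tau> * u))) / 2" for \<tau>
    proof -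
      have "(LBINT v. indicat_real {0..N} \<tau> * ?h v * (cos (\<tau> * v) * cos (\<tau> * u))) =
         (LBINT v. (indicat_real {0..N} \<tau> * cos (\<tau> * u)) * (?h v * cos (\<tau> * v)))"
        by (simp add: mult_ac)
      also have "\<dots> = (indicat_real {0..N} \<tau> * cos (\<tau> * u)) * (LBINT v. ?h v * cos (\<tau> * v))"
        by (rule integral_mult_right_zero)
      finally show ?thesis
        using rotated_exp_cosh_cosine_transform[OF x \<alpha>, of \<tau>] by simp
    qed
    thus ?thesis
      by (simp only: truncated_inverse_def set_lebesgue_integral_def real_scaleR_def integral_divide_zero)
  qed
  also have "(LBINT \<tau>. (LBINT v. indicat_real {0..N} \<tau> * ?h v * (cos (\<tau> * v) * cos (\<tau> * u)))) =
      (LBINT v. (LBINT \<tau>. indicat_real {0..N} \<tau> * ?h v * (cos (\<tau> * v) * cos (\<tau> * u))))"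
  proof (rule Fubini_bounded_kernel[OF _ h])
    show "\<bar>cos (\<tau> * v) * cos (\<tau> * u)\<bar> \<le> 1" for \<tau> v
      unfolding abs_mult using mult_mono[OF abs_cos_le_one abs_cos_le_one] by fastforce
  qed (auto intro: integrable_indicator_Icc)
  also have "\<dots> = (LBINT v. (?h v * dirichlet_kernel N (v - u) + ?h v * dirichlet_kernel N (v + u)) / 2)"
    by (simp only: inner)
  also have "\<dots> = ((LBINT v. ?h v * dirichlet_kernel N (v - u)) + (LBINT v. ?h v * dirichlet_kernel N (v + u))) / 2"
    using iD[of u] iD[of "-u"] by simp
  also have "(LBINT v. ?h v * dirichlet_kernel N (v + u)) = (LBINT v. ?h (- v) * dirichlet_kernel N (- v + u))"
    using lborel_integral_real_affine[of "-1" "\<lambda>v. ?h v * dirichlet_kernel N (v + u)" 0] by simp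
  also have "\<dots> = (LBINT v. ?h v * dirichlet_kernel N (v - u))"
    using dirichlet_kernel_minus[of N "v - u" for v]
    by (simp add: rotated_exp_cosh_def)
  finally show "truncated_inverse \<alpha> x N u = (LBINT v. ?h v * dirichlet_kernel N (v - u)) / 2"
    by simp
qed

text \<open>
  The integrand is the difference of two oscillations with phases \<open>x sinh v sin \<alpha> \<plusminus> N (v - u)\<close>. The
  linear term does not affect the second derivative, so the bound is independent of \<open>N\<close>; the
  remaining amplitude \<open>exp (- x cosh v cos \<alpha>) / (v - u)\<close> decreases from a value of at most \<open>1\<close>.
\<close>

lemma rotated_exp_cosh_dirichlet_tail:
  assumes x: "x > 0" and \<alpha>: "0 < \<alpha>" "\<alpha> \<le> pi / 2" and V: "0 < V" "V \<le> R" and u: "\<bar>u\<bar> + 1 \<le> V"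
  shows "\<bar>integral {V..R} (\<lambda>v. rotated_exp_cosh x \<alpha> v * dirichlet_kernel N (v - u))\<bar>
           \<le> 10 / sqrt (x * sin \<alpha> * sinh V)"
proof -
  have sa: "sin \<alpha> > 0" and ca: "cos \<alpha> \<ge> 0"
    using \<alpha> by (auto intro!: sin_gt_zero cos_ge_zero)
  define \<kappa> where "\<kappa> = x * sin \<alpha> * sinh V"
  have k: "\<kappa> > 0" using x sa V by (simp add: \<kappa>_def)
  define A where "A = (\<lambda>v. exp (- (x * cosh v * cos \<alpha>)) / (v - u))"
  define A' where "A' = (\<lambda>v. (exp (- (x * cosh v * cos \<alpha>)) * - (x * sinh v * cos \<alpha>) * (v - u)
                           - exp (- (x * cosh v * cos \<alpha>)) * 1) / ((v - u) * (v - u)))"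
  have est: "\<bar>integral {V..R} (\<lambda>v. A v * sin (x * sinh v * sin \<alpha> + M * (v - u)))\<bar> \<le> 10 / sqrt \<kappa>" for M
  proof -
    have "\<bar>integral {V..R} (\<lambda>v. A v * sin (x * sinh v * sin \<alpha> + M * (v - u)))\<bar> \<le> 10 * A V / sqrt \<kappa>"
    proof (rule van_der_Corput_sin[where \<theta>' = "\<lambda>v. x * cosh v * sin \<alpha> + M" and
          \<theta>'' = "\<lambda>v. x * sinh v * sin \<alpha>" and A' = A'])
      fix v assume v: "v \<in> {V..R}"
      hence vu: "v - u > 0" using u by auto
      show "((\<lambda>v. x * sinh v * sin \<alpha> + M * (v - u)) has_real_derivative x * cosh v * sin \<alpha> + M) (at v within {V..R})"
        by (auto intro!: derivative_eq_intros)
      show "((\<lambda>v. x * cosh v * sin \<alpha> + M) has_real_derivative x * sinh v * sin \<alpha>) (at v within {V..R})"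
        by (auto intro!: derivative_eq_intros)
      have "sinh V \<le> sinh v" using v by simp
      hence "(x * sin \<alpha>) * sinh V \<le> (x * sin \<alpha>) * sinh v" using x sa by (intro mult_left_mono) auto
      thus "\<kappa> \<le> x * sinh v * sin \<alpha>" by (simp add: \<kappa>_def mult_ac)
      show "(A has_real_derivative A' v) (at v within {V..R})"
        unfolding A_def A'_def using vu
        by (intro DERIV_divide) (auto intro!: derivative_eq_intros)
      have "0 \<le> x * sinh v * cos \<alpha>" using x ca v V by simp
      hence "0 \<le> exp (- (x * cosh v * cos \<alpha>)) * (x * sinh v * cos \<alpha>) * (v - u)" using vu by simp
      moreover have "0 \<le> exp (- (x * cosh v * cos \<alpha>))" by simp
      ultimately have "exp (- (x * cosh v * cos \<alpha>)) * - (x * sinh v * cos \<alpha>) * (v - u)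
                           - exp (- (x * cosh v * cos \<alpha>)) * 1 \<le> 0"
        by (simp only: mult_minus_right mult_minus_left mult_1_right)
      thus "A' v \<le> 0"
        unfolding A'_def using vu by (intro divide_nonpos_pos) auto
    next
      show "0 \<le> A R" using V u by (simp add: A_def)
    qed (use V k in auto)
    also have "A V \<le> 1"
    proof -
      have "exp (- (x * cosh V * cos \<alpha>)) \<le> 1" using x ca by simp
      moreover have "V - u \<ge> 1" using u by linarith
      ultimately have "exp (- (x * cosh V * cos \<alpha>)) \<le> V - u" "V - u > 0" by linarith+
      thus ?thesis by (simp add: A_def)
    qed
    finally show ?thesis using k by (simp add: divide_right_mono)
  qed
  have eq: "rotated_exp_cosh x \<alpha> v * dirichlet_kernel N (v - u) =
      A v * sin (x * sinh v * sin \<alpha> + N * (v - u)) / 2 - A v * sin (x * sinh v * sin \<alpha> + (- N) * (v - u)) / 2"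
    if v: "v \<in> {V..R}" for v
  proof -
    have "v - u \<noteq> 0" using v u by auto
    hence "rotated_exp_cosh x \<alpha> v * dirichlet_kernel N (v - u) =
       A v * (cos (x * sinh v * sin \<alpha>) * sin (N * (v - u)))"
      by (simp add: rotated_exp_cosh_def dirichlet_kernel_def A_def)
    also have "cos (x * sinh v * sin \<alpha>) * sin (N * (v - u)) =
      (sin (x * sinh v * sin \<alpha> + N * (v - u)) - sin (x * sinh v * sin \<alpha> - N * (v - u))) / 2"
      by (rule cos_times_sin)
    finally show ?thesis by (simp add: algebra_simps diff_divide_distrib)
  qed
  have cA: "continuous_on {V..R} A"
    unfolding A_def using u by (intro continuous_intros) auto
  have "integral {V..R} (\<lambda>v. rotated_exp_cosh x \<alpha> v * dirichlet_kernel N (v - u)) =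
     integral {V..R} (\<lambda>v. A v * sin (x * sinh v * sin \<alpha> + N * (v - u)) / 2 -
                           A v * sin (x * sinh v * sin \<alpha> + (- N) * (v - u)) / 2)"
    by (rule Henstock_Kurzweil_Integration.integral_cong[OF eq])
  also have "\<dots> = integral {V..R} (\<lambda>v. A v * sin (x * sinh v * sin \<alpha> + N * (v - u)) / 2) -
      integral {V..R} (\<lambda>v. A v * sin (x * sinh v * sin \<alpha> + (- N) * (v - u)) / 2)"
    by (intro Henstock_Kurzweil_Integration.integral_diff integrable_continuous_interval continuous_intros cA) auto
  also have "\<dots> = integral {V..R} (\<lambda>v. A v * sin (x * sinh v * sin \<alpha> + N * (v - u))) / 2 -
      integral {V..R} (\<lambda>v. A v * sin (x * sinh v * sin \<alpha> + (- N) * (v - u))) / 2"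
    by (simp only: integral_divide)
  finally show ?thesis using est[of N] est[of "- N"] unfolding \<kappa>_def by linarith
qed

lemma rotated_exp_cosh_even: "rotated_exp_cosh x \<alpha> (- v) = rotated_exp_cosh x \<alpha> v"
  by (simp add: rotated_exp_cosh_def)

lemma truncated_inverse_approx_open:
  assumes x: "x > 0" and \<alpha>: "0 < \<alpha>" "\<alpha> < pi / 2" and N: "N \<ge> 0" and u: "\<bar>u\<bar> + 1 \<le> V"
  shows "\<bar>truncated_inverse \<alpha> x N u
            - integral {-V..V} (\<lambda>v. rotated_exp_cosh x \<alpha> v * dirichlet_kernel N (v - u)) / 2\<bar>
           \<le> 10 / sqrt (x * sin \<alpha> * sinh V)"
proof -
  have V: "V > 0" using u by linarith
  let ?f = "\<lambda>u v. rotated_exp_cosh x \<alpha> v * dirichlet_kernel N (v - u)"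
  define \<epsilon> where "\<epsilon> = 10 / sqrt (x * sin \<alpha> * sinh V)"
  have cont: "continuous_on S (?f u)" for S u by (intro continuous_intros)
  have int: "?f u integrable_on {a..b}" for a b u by (rule integrable_continuous_interval[OF cont])
  have tail: "\<bar>integral {V..R} (?f u)\<bar> \<le> \<epsilon>" if "V \<le> R" "\<bar>u\<bar> + 1 \<le> V" for R u
    unfolding \<epsilon>_def using rotated_exp_cosh_dirichlet_tail[OF x \<alpha>(1) less_imp_le[OF \<alpha>(2)] V that(1) that(2)] .
  have part: "\<bar>(LBINT v:{-R..R}. ?f u v) - integral {-V..V} (?f u)\<bar> \<le> 2 * \<epsilon>" if R: "V \<le> R" for R
  proof -
    have "integral {-R..-V} (?f u) = integral {V..R} (\<lambda>v. ?f u (- v))"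
      using Henstock_Kurzweil_Integration.integral_reflect_real[of R V "\<lambda>v. ?f u (- v)"] by simp
    also have "(\<lambda>v. ?f u (- v)) = ?f (- u)"
    proof
      fix v show "?f u (- v) = ?f (- u) v"
        using dirichlet_kernel_minus[of N "v + u"] by (simp add: rotated_exp_cosh_even)
    qed
    finally have "\<bar>integral {-R..-V} (?f u)\<bar> \<le> \<epsilon>" using tail[OF R, of "- u"] u by simp
    moreover have "\<bar>integral {V..R} (?f u)\<bar> \<le> \<epsilon>" using tail[OF R u] .
    moreover have "(LBINT v:{-R..R}. ?f u v) = integral {-R..R} (?f u)"
      by (rule borel_set_integral_eq_integral_Icc[OF cont])
    moreover have "integral {-R..R} (?f u) = integral {-R..-V} (?f u) + integral {-V..R} (?f u)"
      using R V by (intro Henstock_Kurzweil_Integration.integral_combine[symmetric] int) auto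
    moreover have "integral {-V..R} (?f u) = integral {-V..V} (?f u) + integral {V..R} (?f u)"
      using R V by (intro Henstock_Kurzweil_Integration.integral_combine[symmetric] int) auto
    ultimately show ?thesis by linarith
  qed
  have "((\<lambda>R. \<bar>(LBINT v:{-R..R}. ?f u v) - integral {-V..V} (?f u)\<bar>) \<longlongrightarrow>
          \<bar>(LBINT v. ?f u v) - integral {-V..V} (?f u)\<bar>) at_top"
    using truncated_inverse_eq_dirichlet(2)[OF x less_imp_le[OF \<alpha>(1)] \<alpha>(2) N]
    by (intro tendsto_intros tendsto_integral_symmetric_Icc)
  hence "\<bar>(LBINT v. ?f u v) - integral {-V..V} (?f u)\<bar> \<le> 2 * \<epsilon>"
    by (rule tendsto_upperbound) (use part in \<open>auto intro: eventually_mono[OF eventually_ge_at_top[of V]]\<close>)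
  thus ?thesis
    unfolding truncated_inverse_eq_dirichlet(1)[OF x less_imp_le[OF \<alpha>(1)] \<alpha>(2) N] \<epsilon>_def[symmetric]
    by linarith
qed

text \<open>
  The estimate extends to \<open>\<alpha> = pi / 2\<close> by continuity, although the integral over the whole line no
  longer converges absolutely there.
\<close>

lemma truncated_inverse_approx:
  assumes x: "x > 0" and \<alpha>: "0 < \<alpha>" "\<alpha> \<le> pi / 2" and N: "N \<ge> 0" and u: "\<bar>u\<bar> + 1 \<le> V"
  shows "\<bar>truncated_inverse \<alpha> x N u
            - integral {-V..V} (\<lambda>v. rotated_exp_cosh x \<alpha> v * dirichlet_kernel N (v - u)) / 2\<bar>
           \<le> 10 / sqrt (x * sin \<alpha> * sinh V)"
proof (cases "\<alpha> < pi / 2")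
  case True
  thus ?thesis using truncated_inverse_approx_open[OF x \<alpha>(1) _ N u] by blast
next
  case False
  hence \<alpha>_eq: "\<alpha> = pi / 2" using \<alpha> by simp
  have V: "V > 0" using u by linarith
  \<comment> \<open>a sequence of admissible angles increasing to \<open>pi / 2\<close>\<close>
  define A where "A = (\<lambda>k::nat. pi / 2 - 1 / real (Suc k))"
  have A: "0 < A k" "A k < pi / 2" for k
  proof -
    have "1 / real (Suc k) \<le> 1" by simp
    thus "0 < A k" "A k < pi / 2" using pi_gt3 unfolding A_def by (linarith, simp)
  qed
  have limA: "A \<longlonglongrightarrow> pi / 2"
    unfolding A_def using tendsto_diff[OF tendsto_const LIMSEQ_Suc[OF lim_1_over_n]] by simp
  let ?f = "\<lambda>\<alpha> v. rotated_exp_cosh x \<alpha> v * dirichlet_kernel N (v - u)"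
  have 1: "(\<lambda>k. truncated_inverse (A k) x N u) \<longlonglongrightarrow> truncated_inverse (pi / 2) x N u"
    unfolding truncated_inverse_def set_lebesgue_integral_def
  proof (rule integral_dominated_convergence[where w = "\<lambda>t. indicat_real {0..N} t * (cosh (pi / 2 * N) * macdonald_im 0 x)"])
    show "integrable lborel (\<lambda>t. indicat_real {0..N} t * (cosh (pi / 2 * N) * macdonald_im 0 x))"
      by (intro integrable_mult_left integrable_indicator_Icc)
    show "AE t in lborel. (\<lambda>k. indicat_real {0..N} t *\<^sub>R (cosh (A k * t) * macdonald_im t x * cos (t * u)))
        \<longlonglongrightarrow> indicat_real {0..N} t *\<^sub>R (cosh (pi / 2 * t) * macdonald_im t x * cos (t * u))"
      by (intro AE_I2 tendsto_intros limA)
    show "AE t in lborel. norm (indicat_real {0..N} t *\<^sub>R (cosh (A k * t) * macdonald_im t x * cos (t * u)))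
        \<le> indicat_real {0..N} t * (cosh (pi / 2 * N) * macdonald_im 0 x)" for k
    proof (rule AE_I2)
      fix t
      show "norm (indicat_real {0..N} t *\<^sub>R (cosh (A k * t) * macdonald_im t x * cos (t * u)))
        \<le> indicat_real {0..N} t * (cosh (pi / 2 * N) * macdonald_im 0 x)"
      proof (cases "t \<in> {0..N}")
        case True
        have "\<bar>cosh (A k * t) * macdonald_im t x\<bar> * \<bar>cos (t * u)\<bar> \<le> \<bar>cosh (A k * t) * macdonald_im t x\<bar> * 1"
          by (intro mult_left_mono) auto
        also have "\<dots> \<le> cosh (pi / 2 * N) * macdonald_im 0 x"
          using abs_cosh_macdonald_im_le[OF x _ True, of "A k" "pi / 2"] A[of k] by simp
        finally show ?thesis using True by (simp add: abs_mult)
      qed simp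
    qed
  qed simp_all
  have 2: "(\<lambda>k. integral {-V..V} (?f (A k))) \<longlonglongrightarrow> integral {-V..V} (?f (pi / 2))"
  proof -
    have eq: "integral {-V..V} (?f a) = (LBINT v:{-V..V}. ?f a v)" for a
      by (intro borel_set_integral_eq_integral_Icc[symmetric] continuous_intros)
    show ?thesis
      unfolding eq set_lebesgue_integral_def
    proof (rule integral_dominated_convergence[where w = "\<lambda>v. indicat_real {-V..V} v * N"])
      show "integrable lborel (\<lambda>t. indicat_real {-V..V} t * N)"
        by (intro integrable_mult_left integrable_indicator_Icc)
      show "AE v in lborel. (\<lambda>k. indicat_real {-V..V} v *\<^sub>R (?f (A k) v)) \<longlonglongrightarrow> indicat_real {-V..V} v *\<^sub>R (?f (pi / 2) v)"
        unfolding rotated_exp_cosh_def by (intro AE_I2 tendsto_intros limA)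
      show "AE v in lborel. norm (indicat_real {-V..V} v *\<^sub>R (?f (A k) v)) \<le> indicat_real {-V..V} v * N" for k
      proof (rule AE_I2)
        fix v
        have "cos (A k) \<ge> 0" using A[of k] by (intro cos_ge_zero) auto
        hence e: "exp (- (x * cos (A k) * cosh v)) \<le> 1" using x by simp
        have "\<bar>rotated_exp_cosh x (A k) v\<bar> * \<bar>dirichlet_kernel N (v - u)\<bar> \<le> 1 * N"
          using order_trans[OF abs_rotated_exp_cosh_le e] by (intro mult_mono abs_dirichlet_kernel_le[OF N]) auto
        thus "norm (indicat_real {-V..V} v *\<^sub>R (?f (A k) v)) \<le> indicat_real {-V..V} v * N"
          by (simp add: abs_mult indicator_def)
      qed
    qed simp_all
  qed
  have pos: "sqrt (x * sin (pi / 2) * sinh V) \<noteq> 0" using x V by simp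
  show ?thesis unfolding \<alpha>_eq
  proof (rule LIMSEQ_le)
    show "(\<lambda>k. \<bar>truncated_inverse (A k) x N u - integral {-V..V} (?f (A k)) / 2\<bar>)
       \<longlonglongrightarrow> \<bar>truncated_inverse (pi / 2) x N u - integral {-V..V} (?f (pi / 2)) / 2\<bar>"
      by (intro tendsto_intros 1 2) simp
    show "(\<lambda>k. 10 / sqrt (x * sin (A k) * sinh V)) \<longlonglongrightarrow> 10 / sqrt (x * sin (pi / 2) * sinh V)"
      by (intro tendsto_intros limA pos)
    show "\<exists>n. \<forall>k\<ge>n. \<bar>truncated_inverse (A k) x N u - integral {-V..V} (?f (A k)) / 2\<bar> \<le> 10 / sqrt (x * sin (A k) * sinh V)"
      using truncated_inverse_approx_open[OF x A N u] by blast
  qed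
qed

lemma rotated_exp_cosh_C1:
  obtains h' where "\<And>v. (rotated_exp_cosh x \<alpha> has_real_derivative h' v) (at v)" "continuous_on UNIV h'"
proof -
  define h' where "h' = (\<lambda>v. - (x * sinh v * cos \<alpha>) * exp (- (x * cosh v * cos \<alpha>)) * cos (x * sinh v * sin \<alpha>)
     - exp (- (x * cosh v * cos \<alpha>)) * (sin (x * sinh v * sin \<alpha>) * (x * cosh v * sin \<alpha>)))"
  show ?thesis
  proof (rule that[of h'])
    show "(rotated_exp_cosh x \<alpha> has_real_derivative h' v) (at v)" for v
      unfolding rotated_exp_cosh_def[abs_def] h'_def
      by (auto intro!: derivative_eq_intros simp: algebra_simps)
    show "continuous_on UNIV h'" unfolding h'_def by (intro continuous_intros)
  qed
qed

lemma truncated_inverse_bounded: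
  assumes x: "x > 0" and \<alpha>: "0 < \<alpha>" "\<alpha> \<le> pi / 2"
  shows "\<exists>B. \<forall>N u. N \<ge> 0 \<longrightarrow> \<bar>u\<bar> \<le> w \<longrightarrow> \<bar>truncated_inverse \<alpha> x N u\<bar> \<le> B"
proof -
  define V where "V = w + 1"
  obtain h' where h': "\<And>v. (rotated_exp_cosh x \<alpha> has_real_derivative h' v) (at v)" "continuous_on UNIV h'"
    using rotated_exp_cosh_C1[of x \<alpha>] by blast
  obtain B where B: "\<And>N u. N \<ge> 0 \<Longrightarrow> \<bar>u\<bar> \<le> V \<Longrightarrow>
      \<bar>integral {-V..V} (\<lambda>v. rotated_exp_cosh x \<alpha> v * dirichlet_kernel N (v - u))\<bar> \<le> B"
    using dirichlet_kernel_bounded[OF h'] by blast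
  have "\<bar>truncated_inverse \<alpha> x N u\<bar> \<le> 10 / sqrt (x * sin \<alpha> * sinh V) + B / 2" if "N \<ge> 0" "\<bar>u\<bar> \<le> w" for N u
  proof -
    have u: "\<bar>u\<bar> + 1 \<le> V" "\<bar>u\<bar> \<le> V" using that by (auto simp: V_def)
    show ?thesis using truncated_inverse_approx[OF x \<alpha> that(1) u(1)] B[OF that(1) u(2)] by linarith
  qed
  thus ?thesis by blast
qed

text \<open>
  The tail is made small by the choice of \<open>V\<close>, independently of \<open>N\<close>; only then does \<open>N\<close> tend to infinity.
\<close>

lemma truncated_inverse_tendsto:
  assumes x: "x > 0" and \<alpha>: "0 < \<alpha>" "\<alpha> \<le> pi / 2"
  shows "((\<lambda>N. truncated_inverse \<alpha> x N u) \<longlongrightarrow> pi / 2 * rotated_exp_cosh x \<alpha> u) at_top"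
proof (rule tendstoI)
  fix e :: real assume e: "e > 0"
  have sa: "sin \<alpha> > 0" using \<alpha> by (intro sin_gt_zero) auto
  have "((\<lambda>V. 10 / sqrt (x * sin \<alpha> * sinh V)) \<longlongrightarrow> 0) at_top"
  proof -
    have "filterlim (\<lambda>V. sqrt (x * sin \<alpha> * sinh V)) at_top at_top"
      using x sa by (intro filterlim_compose[OF sqrt_at_top] filterlim_tendsto_pos_mult_at_top[OF tendsto_const] sinh_real_at_top) auto
    thus ?thesis by (rule tendsto_divide_0[OF tendsto_const filterlim_at_top_imp_at_infinity])
  qed
  hence "eventually (\<lambda>V. 10 / sqrt (x * sin \<alpha> * sinh V) < e / 2) at_top"
    using e by (intro order_tendstoD) auto
  hence "eventually (\<lambda>V. 10 / sqrt (x * sin \<alpha> * sinh V) < e / 2 \<and> \<bar>u\<bar> + 1 \<le> V) at_top"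
    using eventually_ge_at_top by (rule eventually_conj)
  then obtain V where V: "10 / sqrt (x * sin \<alpha> * sinh V) < e / 2" "\<bar>u\<bar> + 1 \<le> V"
    using eventually_happens'[OF trivial_limit_at_top_linorder] by blast
  obtain h' where h': "\<And>v. (rotated_exp_cosh x \<alpha> has_real_derivative h' v) (at v)" "continuous_on UNIV h'"
    using rotated_exp_cosh_C1[of x \<alpha>] by blast
  have "((\<lambda>N. integral {-V..V} (\<lambda>v. rotated_exp_cosh x \<alpha> v * dirichlet_kernel N (v - u)))
      \<longlongrightarrow> pi * rotated_exp_cosh x \<alpha> u) at_top"
    using V by (intro dirichlet_kernel_tendsto[OF h'(1)]) auto
  hence "eventually (\<lambda>N. dist (integral {-V..V} (\<lambda>v. rotated_exp_cosh x \<alpha> v * dirichlet_kernel N (v - u)))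
      (pi * rotated_exp_cosh x \<alpha> u) < e) at_top"
    using e by (rule tendstoD)
  thus "eventually (\<lambda>N. dist (truncated_inverse \<alpha> x N u) (pi / 2 * rotated_exp_cosh x \<alpha> u) < e) at_top"
    using eventually_ge_at_top[of 0]
  proof eventually_elim
    case (elim N)
    have "pi / 2 * rotated_exp_cosh x \<alpha> u = (pi * rotated_exp_cosh x \<alpha> u) / 2" by simp
    thus ?case
      using truncated_inverse_approx[OF x \<alpha> elim(2) V(2)] elim(1) V(1) unfolding dist_real_def by linarith
  qed
qed

section \<open>Parseval identities with a cutoff\<close>

text \<open>
  The cosine transform of a function on \<open>{0..w}\<close>.
\<close>

definition cosine_transform :: "(real \<Rightarrow> real) \<Rightarrow> real \<Rightarrow> real \<Rightarrow> real" where
  "cosine_transform G w \<tau> = (LBINT u:{0..w}. G u * cos (\<tau> * u))"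

lemma borel_measurable_truncated_inverse [measurable]:
  "(\<lambda>u. truncated_inverse \<alpha> x N u) \<in> borel_measurable borel"
  unfolding truncated_inverse_def set_lebesgue_integral_def by measurable

lemma truncated_Parseval:
  assumes x: "x > 0" and G: "set_integrable lborel {0..w} G"
  shows "(LBINT \<tau>:{0..N}. cosh (\<alpha> * \<tau>) * macdonald_im \<tau> x * cosine_transform G w \<tau>) =
           (LBINT u:{0..w}. G u * truncated_inverse \<alpha> x N u)"
proof -
  let ?f = "\<lambda>\<tau>. indicat_real {0..N} \<tau> *\<^sub>R (cosh (\<alpha> * \<tau>) * macdonald_im \<tau> x)"
  let ?g = "\<lambda>u. indicat_real {0..w} u *\<^sub>R G u"
  have "(LBINT \<tau>:{0..N}. cosh (\<alpha> * \<tau>) * macdonald_im \<tau> x * cosine_transform G w \<tau>) =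
     (LBINT \<tau>. LBINT u. ?f \<tau> * ?g u * cos (\<tau> * u))"
    unfolding set_lebesgue_integral_def cosine_transform_def
    by (simp add: mult.assoc)
  also have "\<dots> = (LBINT u. LBINT \<tau>. ?f \<tau> * ?g u * cos (\<tau> * u))"
    by (rule Fubini_bounded_kernel)
       (use set_integrable_cosh_macdonald_im[OF x] G in \<open>auto simp: set_integrable_def\<close>)
  also have "\<dots> = (LBINT u. LBINT \<tau>. ?g u * (?f \<tau> * cos (\<tau> * u)))"
    by (simp only: mult_ac)
  also have "\<dots> = (LBINT u:{0..w}. G u * truncated_inverse \<alpha> x N u)"
    unfolding set_lebesgue_integral_def truncated_inverse_def
    by (simp add: mult.assoc)
  finally show ?thesis .
qed

text \<open>
  The constant \<open>B\<close> depends on \<open>x\<close>, \<open>\<alpha>\<close> and \<open>w\<close> only. Its uniformity in \<open>G\<close> makes it serve all terms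
  of a series at once.
\<close>

lemma truncated_Parseval_bounded:
  assumes x: "x > 0" and \<alpha>: "0 < \<alpha>" "\<alpha> \<le> pi / 2" and w: "w \<ge> 0"
  shows "\<exists>B. \<forall>N G M. N \<ge> 0 \<longrightarrow> G \<in> borel_measurable borel \<longrightarrow> (\<forall>u\<in>{0..w}. \<bar>G u\<bar> \<le> M) \<longrightarrow>
     \<bar>LBINT \<tau>:{0..N}. cosh (\<alpha> * \<tau>) * macdonald_im \<tau> x * cosine_transform G w \<tau>\<bar> \<le> M * B"
proof -
  obtain B where B: "\<And>N u. N \<ge> 0 \<Longrightarrow> \<bar>u\<bar> \<le> w \<Longrightarrow> \<bar>truncated_inverse \<alpha> x N u\<bar> \<le> B"
    using truncated_inverse_bounded[OF x \<alpha>] by blast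
  have "\<bar>LBINT \<tau>:{0..N}. cosh (\<alpha> * \<tau>) * macdonald_im \<tau> x * cosine_transform G w \<tau>\<bar> \<le> M * (B * w)"
    if N: "N \<ge> 0" and [measurable]: "G \<in> borel_measurable borel" and M: "\<forall>u\<in>{0..w}. \<bar>G u\<bar> \<le> M" for N G M
  proof -
    have bd: "\<bar>G u * truncated_inverse \<alpha> x N u\<bar> \<le> M * B" if "u \<in> {0..w}" for u
    proof -
      have "\<bar>G u\<bar> \<le> M" "\<bar>truncated_inverse \<alpha> x N u\<bar> \<le> B"
        using M B[OF N, of u] that by auto
      thus ?thesis unfolding abs_mult by (intro mult_mono) auto
    qed
    have i: "set_integrable lborel {0..w} (\<lambda>u. G u * truncated_inverse \<alpha> x N u)"
      by (rule set_integrable_bounded_Icc[where B = "M * B"]) (use bd in auto)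
    have "norm (integral {0..w} (\<lambda>u. G u * truncated_inverse \<alpha> x N u)) \<le> integral {0..w} (\<lambda>u. M * B)"
      using bd by (intro integral_norm_bound_integral set_borel_integral_eq_integral(1)[OF i]) auto
    also have "(LBINT \<tau>:{0..N}. cosh (\<alpha> * \<tau>) * macdonald_im \<tau> x * cosine_transform G w \<tau>) =
           integral {0..w} (\<lambda>u. G u * truncated_inverse \<alpha> x N u)"
      using truncated_Parseval[OF x set_integrable_bounded_Icc[of G 0 w M]] M
        set_borel_integral_eq_integral(2)[OF i] by simp
    note this [symmetric]
    finally show ?thesis using w by (simp add: mult_ac)
  qed
  thus ?thesis by blast
qed

lemma truncated_Parseval_tendsto:
  assumes x: "x > 0" and \<alpha>: "0 < \<alpha>" "\<alpha> \<le> pi / 2"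
    and G [measurable]: "G \<in> borel_measurable borel" and M: "\<And>u. u \<in> {0..w} \<Longrightarrow> \<bar>G u\<bar> \<le> M"
  shows "((\<lambda>N. LBINT \<tau>:{0..N}. cosh (\<alpha> * \<tau>) * macdonald_im \<tau> x * cosine_transform G w \<tau>)
           \<longlongrightarrow> pi / 2 * (LBINT u:{0..w}. G u * rotated_exp_cosh x \<alpha> u)) at_top"
proof -
  obtain B where B: "\<And>N u. N \<ge> 0 \<Longrightarrow> \<bar>u\<bar> \<le> w \<Longrightarrow> \<bar>truncated_inverse \<alpha> x N u\<bar> \<le> B"
    using truncated_inverse_bounded[OF x \<alpha>] by blast
  have iG: "set_integrable lborel {0..w} G"
    by (rule set_integrable_bounded_Icc[where B = M]) (use M in auto)
  have "((\<lambda>N. LBINT u. indicat_real {0..w} u *\<^sub>R (G u * truncated_inverse \<alpha> x N u))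
     \<longlongrightarrow> (LBINT u. indicat_real {0..w} u *\<^sub>R (G u * (pi / 2 * rotated_exp_cosh x \<alpha> u)))) at_top"
  proof (rule integral_dominated_convergence_at_top[where w = "\<lambda>u. indicat_real {0..w} u * (M * B)"])
    show "integrable lborel (\<lambda>u. indicat_real {0..w} u * (M * B))"
      by (intro integrable_mult_left integrable_indicator_Icc)
    show "AE u in lborel. ((\<lambda>N. indicat_real {0..w} u *\<^sub>R (G u * truncated_inverse \<alpha> x N u))
        \<longlongrightarrow> indicat_real {0..w} u *\<^sub>R (G u * (pi / 2 * rotated_exp_cosh x \<alpha> u))) at_top"
      by (intro AE_I2 tendsto_intros truncated_inverse_tendsto[OF x \<alpha>])
    show "\<forall>\<^sub>F N in at_top. AE u in lborel. norm (indicat_real {0..w} u *\<^sub>R (G u * truncated_inverse \<alpha> x N u))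
        \<le> indicat_real {0..w} u * (M * B)"
      using eventually_ge_at_top[of 0]
    proof eventually_elim
      case (elim N)
      show ?case
      proof (rule AE_I2)
        fix u
        show "norm (indicat_real {0..w} u *\<^sub>R (G u * truncated_inverse \<alpha> x N u)) \<le> indicat_real {0..w} u * (M * B)"
        proof (cases "u \<in> {0..w}")
          case True
          have "\<bar>G u\<bar> \<le> M" "\<bar>truncated_inverse \<alpha> x N u\<bar> \<le> B"
            using M B[OF elim, of u] True by auto
          hence "\<bar>G u\<bar> * \<bar>truncated_inverse \<alpha> x N u\<bar> \<le> M * B" by (intro mult_mono) auto
          thus ?thesis using True by (simp add: abs_mult)
        qed simp
      qed
    qed
  qed simp_all
  moreover have "(LBINT u. indicat_real {0..w} u *\<^sub>R (G u * (pi / 2 * rotated_exp_cosh x \<alpha> u))) =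
      pi / 2 * (LBINT u:{0..w}. G u * rotated_exp_cosh x \<alpha> u)"
  proof -
    have "(LBINT u. indicat_real {0..w} u *\<^sub>R (G u * (pi / 2 * rotated_exp_cosh x \<alpha> u))) =
      (LBINT u. pi / 2 * (indicat_real {0..w} u *\<^sub>R (G u * rotated_exp_cosh x \<alpha> u)))"
      by (simp only: real_scaleR_def mult_ac)
    thus ?thesis by (simp only: set_lebesgue_integral_def integral_mult_right_zero)
  qed
  ultimately show ?thesis
    unfolding truncated_Parseval[OF x iG] unfolding set_lebesgue_integral_def by simp
qed

section \<open>Interchanging series with integrals and limits\<close>

lemma has_sum_atLeast_1_iff:
  fixes b :: "nat \<Rightarrow> 'a::{comm_monoid_add, topological_space}"
  shows "(b has_sum s) {1..} \<longleftrightarrow> ((\<lambda>k. b (Suc k)) has_sum s) UNIV"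
proof -
  have "{1..} = range Suc" by (auto simp: image_iff) (metis Suc_le_D)
  thus ?thesis using has_sum_reindex[of Suc UNIV b s] by (simp add: o_def)
qed

lemma summable_on_atLeast_1_iff:
  fixes b :: "nat \<Rightarrow> 'a::{comm_monoid_add, topological_space}"
  shows "b summable_on {1..} \<longleftrightarrow> (\<lambda>k. b (Suc k)) summable_on UNIV"
  unfolding summable_on_def by (simp only: has_sum_atLeast_1_iff)

lemma infsum_atLeast_1_eq_suminf:
  fixes b :: "nat \<Rightarrow> complex"
  assumes "summable (\<lambda>k. norm (b (Suc k)))"
  shows "b summable_on {1..}" and "(\<Sum>\<^sub>\<infinity>m\<in>{1..}. b m) = (\<Sum>k. b (Suc k))"
proof -
  have "((\<lambda>k. b (Suc k)) has_sum (\<Sum>k. b (Suc k))) UNIV"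
    using norm_summable_imp_has_sum[OF assms summable_sums[OF summable_norm_cancel[OF assms]]] .
  hence "(b has_sum (\<Sum>k. b (Suc k))) {1..}" by (simp only: has_sum_atLeast_1_iff)
  thus "b summable_on {1..}" "(\<Sum>\<^sub>\<infinity>m\<in>{1..}. b m) = (\<Sum>k. b (Suc k))"
    by (auto simp: summable_on_def infsumI)
qed

lemma set_integral_weighted_suminf:
  fixes c :: "nat \<Rightarrow> complex" and H :: "nat \<Rightarrow> real \<Rightarrow> real"
  assumes c: "summable (\<lambda>k. norm (c k))"
    and H [measurable]: "\<And>k. H k \<in> borel_measurable borel" and A [measurable]: "A \<in> sets borel"
    and W: "set_integrable lborel A W" and bd: "\<And>k t. t \<in> A \<Longrightarrow> \<bar>H k t\<bar> \<le> W t"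
  shows "set_integrable lborel A (\<lambda>t. \<Sum>k. c k * of_real (H k t))"
    and "(LBINT t:A. (\<Sum>k. c k * of_real (H k t))) = (\<Sum>k. c k * of_real (LBINT t:A. H k t))"
    and "\<And>k. set_integrable lborel A (H k)"
proof -
  have iH: "set_integrable lborel A (H k)" for k
    by (rule set_integrable_bound[OF W]) (use bd abs_ge_self order_trans in \<open>auto simp: set_borel_measurable_def intro!: AE_I2\<close>, blast)
  show "\<And>k. set_integrable lborel A (H k)" by (rule iH)
  let ?f = "\<lambda>k t. indicat_real A t *\<^sub>R (c k * of_real (H k t))"
  have f_eq: "?f k = (\<lambda>t. c k * of_real (indicat_real A t *\<^sub>R H k t))" for k
    by (auto simp: scaleR_conv_of_real)
  have intf: "integrable lborel (?f k)" for k
    unfolding f_eq using iH[of k] by (intro integrable_mult_right integrable_of_real) (simp add: set_integrable_def)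
  have nf: "norm (?f k t) \<le> norm (c k) * (indicat_real A t *\<^sub>R W t)" for k t
    using bd[of t k] by (auto simp: indicator_def norm_mult intro: mult_left_mono)
  have iW: "integrable lborel (\<lambda>t. indicat_real A t *\<^sub>R W t)" using W by (simp add: set_integrable_def)
  have sm: "AE t in lborel. summable (\<lambda>k. norm (?f k t))"
  proof (rule AE_I2)
    fix t
    show "summable (\<lambda>k. norm (?f k t))"
      by (rule summable_comparison_test[OF _ summable_mult2[OF c, of "indicat_real A t *\<^sub>R W t"]])
         (use nf in auto)
  qed
  have si: "summable (\<lambda>k. LBINT t. norm (?f k t))"
  proof (rule summable_comparison_test[OF _ summable_mult2[OF c, of "LBINT t. indicat_real A t *\<^sub>R W t"]])
    have "norm (LBINT t. norm (?f k t)) \<le> norm (c k) * (LBINT t. indicat_real A t *\<^sub>R W t)" for k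
    proof -
      have "(LBINT t. norm (?f k t)) \<le> (LBINT t. norm (c k) * (indicat_real A t *\<^sub>R W t))"
        by (rule integral_mono[OF integrable_norm[OF intf] integrable_mult_right[OF iW] nf])
      thus ?thesis by simp
    qed
    thus "\<exists>N. \<forall>k\<ge>N. norm (LBINT t. norm (?f k t)) \<le> norm (c k) * (LBINT t. indicat_real A t *\<^sub>R W t)" by blast
  qed
  have sum_eq: "(\<Sum>k. ?f k t) = indicat_real A t *\<^sub>R (\<Sum>k. c k * of_real (H k t))" for t
    by (cases "t \<in> A") auto
  show "set_integrable lborel A (\<lambda>t. \<Sum>k. c k * of_real (H k t))"
    unfolding set_integrable_def sum_eq[symmetric] by (rule integrable_suminf[OF intf sm si])
  have "(LBINT t:A. (\<Sum>k. c k * of_real (H k t))) = (\<Sum>k. LBINT t. ?f k t)"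
    unfolding set_lebesgue_integral_def sum_eq[symmetric] by (rule integral_suminf[OF intf sm si])
  also have "(\<lambda>k. LBINT t. ?f k t) = (\<lambda>k. c k * of_real (LBINT t:A. H k t))"
    unfolding f_eq set_lebesgue_integral_def by (simp only: integral_mult_right_zero integral_complex_of_real)
  finally show "(LBINT t:A. (\<Sum>k. c k * of_real (H k t))) = (\<Sum>k. c k * of_real (LBINT t:A. H k t))" .
qed

lemma tendsto_weighted_suminf:
  fixes c :: "nat \<Rightarrow> complex" and T :: "nat \<Rightarrow> 'a \<Rightarrow> real"
  assumes c: "summable (\<lambda>k. norm (c k))" and F: "F \<noteq> bot"
    and lim: "\<And>k. (T k \<longlongrightarrow> b k) F" and bd: "\<forall>\<^sub>F x in F. \<forall>k. \<bar>T k x\<bar> \<le> M"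
  shows "((\<lambda>x. \<Sum>k. c k * of_real (T k x)) \<longlongrightarrow> (\<Sum>k. c k * of_real (b k))) F"
proof -
  have "\<forall>\<^sub>F p in at_top \<times>\<^sub>F F. True \<and> (\<forall>k. \<bar>T k (snd p)\<bar> \<le> M)"
    by (rule eventually_prodI[OF always_eventually bd]) simp
  hence "\<forall>\<^sub>F (k, x) in at_top \<times>\<^sub>F F. norm (c k * of_real (T k x)) \<le> norm (c k) * M"
    by (rule eventually_mono) (auto simp: norm_mult intro!: mult_left_mono)
  moreover have "\<And>k. ((\<lambda>x. c k * of_real (T k x)) \<longlongrightarrow> c k * of_real (b k)) F"
    by (intro tendsto_intros lim)
  ultimately show ?thesis
    using tannerys_theorem[where a = "\<lambda>k x. c k * of_real (T k x)" and M = "\<lambda>k. norm (c k) * M"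
        and F = F and b = "\<lambda>k. c k * of_real (b k)"] summable_mult2[OF c] F by blast
qed

section \<open>The two kernels at imaginary index\<close>

lemma integral_even_half_line:
  fixes g :: "real \<Rightarrow> real"
  assumes g: "integrable lborel g" and even: "\<And>v. g (- v) = g v"
  shows "(LBINT v:{0..}. g v) = (LBINT v. g v) / 2"
proof -
  have i: "integrable lborel (\<lambda>v. indicat_real A v * g v)" if "A \<in> sets borel" for A
    using integrable_mult_indicator[of A lborel g] g that by simp
  have "(LBINT v. g v) = (LBINT v. indicat_real {0..} v * g v + indicat_real {..<0} v * g v)"
    by (rule Bochner_Integration.integral_cong) (auto simp: indicator_def)
  also have "\<dots> = (LBINT v. indicat_real {0..} v * g v) + (LBINT v. indicat_real {..<0} v * g v)"
    by (intro Bochner_Integration.integral_add i) auto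
  also have "(LBINT v. indicat_real {..<0} v * g v) = (LBINT v. indicat_real {..<0} (- v) * g v)"
    using lborel_integral_real_affine[of "-1" "\<lambda>v. indicat_real {..<0} v * g v" 0] by (simp add: even)
  also have "\<dots> = (LBINT v. indicat_real {0..} v * g v)"
  proof (rule integral_cong_AE)
    have [measurable]: "g \<in> borel_measurable borel" using borel_measurable_integrable[OF g] by simp
    show "(\<lambda>v. indicat_real {..<0} (- v) * g v) \<in> borel_measurable lborel"
         "(\<lambda>v. indicat_real {0..} v * g v) \<in> borel_measurable lborel" by measurable
    show "AE v in lborel. indicat_real {..<0} (- v) * g v = indicat_real {0..} v * g v"
      using AE_lborel_singleton[of 0] by eventually_elim (auto simp: indicator_def)
  qed
  finally show ?thesis by (simp add: set_lebesgue_integral_def)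
qed

lemma macdonald_K_imaginary:
  assumes x: "x > 0"
  shows "macdonald_K (\<i> * of_real \<tau>) x = of_real (macdonald_im \<tau> x)"
proof -
  have "complex_of_real (exp (- x * cosh u)) * cosh (\<i> * of_real \<tau> * of_real u) =
      of_real (exp (- (x * cosh u)) * cos (\<tau> * u))" for u
    using cos_conv_cosh[of "of_real \<tau> * of_real u"] by (simp add: mult.assoc flip: cos_of_real)
  hence "macdonald_K (\<i> * of_real \<tau>) x =
      (LBINT u:{0..}. complex_of_real (exp (- (x * cosh u)) * cos (\<tau> * u)))"
    by (simp add: macdonald_K_def)
  also have "\<dots> = of_real (LBINT u:{0..}. exp (- (x * cosh u)) * cos (\<tau> * u))"
    by (rule set_integral_complex_of_real)
  also have "(LBINT u:{0..}. exp (- (x * cosh u)) * cos (\<tau> * u)) = macdonald_im \<tau> x"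
    unfolding macdonald_im_def
  proof (rule integral_even_half_line)
    show "integrable lborel (\<lambda>v. exp (- (x * cosh v)) * cos (\<tau> * v))"
      by (rule Bochner_Integration.integrable_bound[OF integrable_exp_cosh[OF x]])
         (auto simp: abs_mult mult_left_le)
  qed simp
  finally show ?thesis .
qed

text \<open>
  At \<open>\<tau> = 0\<close> both sides are \<open>0\<close>, by division by zero.
\<close>

lemma macdonald_Ks_imaginary:
  "macdonald_Ks x (\<i> * of_real \<tau>) w =
     of_real ((LBINT u:{0..w}. sin (x * sinh u) * sin (\<tau> * u)) / sinh (pi * \<tau> / 2))"
proof -
  have s: "sinh (\<i> * complex_of_real t) = \<i> * of_real (sin t)" for t
    using sin_conv_sinh[of "of_real t"] by (simp flip: sin_of_real)
  have s': "sin (\<i> * complex_of_real t) = \<i> * of_real (sinh t)" for t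
    by (simp add: sin_i_times sinh_field_def exp_minus flip: exp_of_real)
  have "complex_of_real (sin (x * sinh u)) * sinh (\<i> * of_real \<tau> * of_real u) =
      \<i> * of_real (sin (x * sinh u) * sin (\<tau> * u))" for u
    using s[of "\<tau> * u"] by (simp add: mult_ac)
  hence "(LBINT u:{0..w}. complex_of_real (sin (x * sinh u)) * sinh (\<i> * of_real \<tau> * of_real u)) =
      \<i> * (LBINT u:{0..w}. complex_of_real (sin (x * sinh u) * sin (\<tau> * u)))"
    by (simp only: set_integral_mult_right)
  also have "(LBINT u:{0..w}. complex_of_real (sin (x * sinh u) * sin (\<tau> * u))) =
      of_real (LBINT u:{0..w}. sin (x * sinh u) * sin (\<tau> * u))"
    by (rule set_integral_complex_of_real)
  finally show ?thesis
    using s'[of "pi * \<tau> / 2"] by (simp add: macdonald_Ks_def mult_ac)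
qed

text \<open>
  The function \<open>cos (m y)\<close> of \<open>y = sinh u\<close>, multiplied by the Jacobian \<open>cosh u = dy / du\<close>.
\<close>

definition cosine_mode :: "nat \<Rightarrow> real \<Rightarrow> real" where
  "cosine_mode m u = cosh u * cos (real m * sinh u)"

lemma continuous_on_cosine_mode: "continuous_on S (cosine_mode m)"
  unfolding cosine_mode_def[abs_def] by (intro continuous_intros)

lemma borel_measurable_cosine_mode [measurable]: "cosine_mode m \<in> borel_measurable borel"
  by (rule borel_measurable_continuous_onI[OF continuous_on_cosine_mode])

lemma abs_cosine_mode_le: "u \<in> {0..w} \<Longrightarrow> \<bar>cosine_mode m u\<bar> \<le> cosh w"
  using mult_mono[of "cosh u" "cosh w" "\<bar>cos (real m * sinh u)\<bar>" 1] cosh_le_of_abs_le[of u w]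
  by (auto simp: cosine_mode_def abs_mult)

lemma borel_measurable_cosine_transform [measurable]:
  assumes [measurable]: "G \<in> borel_measurable borel"
  shows "cosine_transform G w \<in> borel_measurable borel"
  unfolding cosine_transform_def[abs_def] set_lebesgue_integral_def by measurable

lemma abs_cosine_transform_mode_le:
  assumes w: "w \<ge> 0"
  shows "\<bar>cosine_transform (cosine_mode m) w \<tau>\<bar> \<le> cosh w * w"
proof -
  have c: "continuous_on {0..w} (\<lambda>u. cosine_mode m u * cos (\<tau> * u))"
    by (intro continuous_intros continuous_on_cosine_mode)
  have "norm (integral {0..w} (\<lambda>u. cosine_mode m u * cos (\<tau> * u))) \<le> cosh w * (w - 0)"
  proof (rule integral_bound[OF w c])
    show "norm (cosine_mode m u * cos (\<tau> * u)) \<le> cosh w" if "u \<in> {0..w}" for u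
      using mult_mono[OF abs_cosine_mode_le[OF that] abs_cos_le_one[of "\<tau> * u"]] by (simp add: abs_mult)
  qed
  thus ?thesis by (simp add: cosine_transform_def borel_set_integral_eq_integral_Icc[OF c])
qed

lemma arsinh_pi_nonneg: "0 \<le> (arsinh pi :: real)"
  using sinh_real_nonneg_iff[of "arsinh pi"] by simp

text \<open>
  The function \<open>sin (m sinh u) cos (\<tau> u)\<close> vanishes at both ends of \<open>{0..arsinh pi}\<close>, as \<open>sin (m pi) = 0\<close>.
\<close>

lemma sine_integral_by_parts:
  "\<tau> * (LBINT u:{0..arsinh pi}. sin (real m * sinh u) * sin (\<tau> * u)) =
     real m * cosine_transform (cosine_mode m) (arsinh pi) \<tau>"
proof -
  let ?w = "arsinh pi :: real"
  have w: "0 \<le> ?w" by (rule arsinh_pi_nonneg)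
  have "((\<lambda>u. real m * (cosine_mode m u * cos (\<tau> * u)) - \<tau> * (sin (real m * sinh u) * sin (\<tau> * u)))
      has_integral (sin (real m * sinh ?w) * cos (\<tau> * ?w) - sin (real m * sinh 0) * cos (\<tau> * 0))) {0..?w}"
  proof (rule fundamental_theorem_of_calculus[OF w])
    fix u :: real assume "u \<in> {0..?w}"
    have "((\<lambda>u. sin (real m * sinh u) * cos (\<tau> * u)) has_real_derivative
       real m * (cosine_mode m u * cos (\<tau> * u)) - \<tau> * (sin (real m * sinh u) * sin (\<tau> * u))) (at u within {0..?w})"
      unfolding cosine_mode_def by (auto intro!: derivative_eq_intros simp: algebra_simps)
    thus "((\<lambda>u. sin (real m * sinh u) * cos (\<tau> * u)) has_vector_derivative
       real m * (cosine_mode m u * cos (\<tau> * u)) - \<tau> * (sin (real m * sinh u) * sin (\<tau> * u))) (at u within {0..?w})"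
      by (simp add: has_real_derivative_iff_has_vector_derivative)
  qed
  hence "integral {0..?w} (\<lambda>u. real m * (cosine_mode m u * cos (\<tau> * u)) - \<tau> * (sin (real m * sinh u) * sin (\<tau> * u))) = 0"
    by (simp add: integral_unique)
  also have "integral {0..?w} (\<lambda>u. real m * (cosine_mode m u * cos (\<tau> * u)) - \<tau> * (sin (real m * sinh u) * sin (\<tau> * u)))
     = integral {0..?w} (\<lambda>u. real m * (cosine_mode m u * cos (\<tau> * u))) - integral {0..?w} (\<lambda>u. \<tau> * (sin (real m * sinh u) * sin (\<tau> * u)))"
    by (intro Henstock_Kurzweil_Integration.integral_diff integrable_continuous_interval continuous_intros continuous_on_cosine_mode)
  also have "\<dots> = real m * integral {0..?w} (\<lambda>u. cosine_mode m u * cos (\<tau> * u)) - \<tau> * integral {0..?w} (\<lambda>u. sin (real m * sinh u) * sin (\<tau> * u))"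
    by (simp only: integral_mult_right)
  also have "integral {0..?w} (\<lambda>u. cosine_mode m u * cos (\<tau> * u)) = cosine_transform (cosine_mode m) ?w \<tau>"
    unfolding cosine_transform_def
    by (intro borel_set_integral_eq_integral_Icc[symmetric] continuous_intros continuous_on_cosine_mode)
  also have "integral {0..?w} (\<lambda>u. sin (real m * sinh u) * sin (\<tau> * u)) = (LBINT u:{0..?w}. sin (real m * sinh u) * sin (\<tau> * u))"
    by (intro borel_set_integral_eq_integral_Icc[symmetric] continuous_intros)
  finally show ?thesis by simp
qed

lemma sinh_times_macdonald_Ks:
  "of_real (\<tau> * sinh (pi * \<tau> / 2)) * macdonald_Ks (real m) (\<i> * of_real \<tau>) (arsinh pi) =
     complex_of_real (real m * cosine_transform (cosine_mode m) (arsinh pi) \<tau>)"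
proof -
  have "of_real (\<tau> * sinh (pi * \<tau> / 2)) * macdonald_Ks (real m) (\<i> * of_real \<tau>) (arsinh pi) =
     complex_of_real (\<tau> * (LBINT u:{0..arsinh pi}. sin (real m * sinh u) * sin (\<tau> * u)))"
    by (cases "\<tau> = 0") (simp_all add: macdonald_Ks_imaginary)
  thus ?thesis by (simp only: sine_integral_by_parts)
qed

lemma norm_macdonald_Ks_le:
  assumes w: "w \<ge> 0"
  shows "norm (macdonald_Ks x (\<i> * of_real \<tau>) w) \<le> w / \<bar>sinh (pi * \<tau> / 2)\<bar>"
proof -
  have c: "continuous_on {0..w} (\<lambda>u. sin (x * sinh u) * sin (\<tau> * u))"
    by (intro continuous_intros)
  have "norm (integral {0..w} (\<lambda>u. sin (x * sinh u) * sin (\<tau> * u))) \<le> 1 * (w - 0)"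
  proof (rule integral_bound[OF w c])
    show "norm (sin (x * sinh u) * sin (\<tau> * u)) \<le> 1" for u
      using mult_mono[OF abs_sin_le_one[of "x * sinh u"] abs_sin_le_one[of "\<tau> * u"]] by (simp add: abs_mult)
  qed
  hence "\<bar>LBINT u:{0..w}. sin (x * sinh u) * sin (\<tau> * u)\<bar> \<le> w"
    by (simp add: borel_set_integral_eq_integral_Icc[OF c])
  thus ?thesis
    unfolding macdonald_Ks_imaginary norm_of_real abs_divide by (rule divide_right_mono) simp
qed

text \<open>
  Under \<open>y = sinh u\<close> this is the integral of \<open>cos (m y) cos (n y)\<close> over \<open>{0..pi}\<close>.
\<close>

lemma cosine_mode_orthogonal:
  assumes m: "m \<ge> 1" and n: "n \<ge> 1"
  shows "(LBINT u:{0..arsinh pi}. cosine_mode m u * rotated_exp_cosh (real n) (pi / 2) u) =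
           (if m = n then pi / 2 else 0)"
proof -
  let ?w = "arsinh pi :: real"
  have w: "0 \<le> ?w" by (rule arsinh_pi_nonneg)
  define p where "p = real m + real n"
  define q where "q = real m - real n"
  have p: "p \<noteq> 0" using m by (simp add: p_def)
  define P where "P = (\<lambda>u. sin (p * sinh u) / (2 * p) + (if m = n then sinh u / 2 else sin (q * sinh u) / (2 * q)))"
  have "((\<lambda>u. cosine_mode m u * rotated_exp_cosh (real n) (pi / 2) u) has_integral (P ?w - P 0)) {0..?w}"
  proof (rule fundamental_theorem_of_calculus[OF w])
    fix u :: real assume "u \<in> {0..?w}"
    have "cosine_mode m u * rotated_exp_cosh (real n) (pi / 2) u =
       cosh u * (cos (real m * sinh u) * cos (real n * sinh u))"
      by (simp add: cosine_mode_def rotated_exp_cosh_def)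
    also have "\<dots> = cos (p * sinh u) * cosh u / 2 + cos (q * sinh u) * cosh u / 2"
      by (simp add: cos_times_cos p_def q_def algebra_simps add_divide_distrib)
    finally have e: "cosine_mode m u * rotated_exp_cosh (real n) (pi / 2) u =
       cos (p * sinh u) * cosh u / 2 + cos (q * sinh u) * cosh u / 2" .
    have "(P has_real_derivative cos (p * sinh u) * cosh u / 2 + cos (q * sinh u) * cosh u / 2) (at u within {0..?w})"
    proof (cases "m = n")
      case True
      thus ?thesis unfolding P_def using p
        by (auto intro!: derivative_eq_intros simp: q_def)
    next
      case False
      hence "q \<noteq> 0" by (simp add: q_def)
      thus ?thesis unfolding P_def using p False
        by (auto intro!: derivative_eq_intros simp: mult.commute)
    qed
    thus "(P has_vector_derivative cosine_mode m u * rotated_exp_cosh (real n) (pi / 2) u) (at u within {0..?w})"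
      by (simp add: has_real_derivative_iff_has_vector_derivative e)
  qed
  moreover have "sin (p * pi) = 0" "sin (q * pi) = 0"
    by (simp_all add: p_def q_def distrib_right left_diff_distrib sin_add sin_diff)
  hence "P ?w - P 0 = (if m = n then pi / 2 else 0)" by (simp add: P_def)
  moreover have "(LBINT u:{0..?w}. cosine_mode m u * rotated_exp_cosh (real n) (pi / 2) u) =
     integral {0..?w} (\<lambda>u. cosine_mode m u * rotated_exp_cosh (real n) (pi / 2) u)"
    by (intro borel_set_integral_eq_integral_Icc continuous_intros continuous_on_cosine_mode)
  ultimately show ?thesis by (simp add: integral_unique)
qed

text \<open>
  Exponential decay in \<open>\<tau>\<close> at every rate \<open>\<delta> < pi / 2\<close>, with a constant independent of \<open>x \<ge> 1\<close>: the
  cosine transform of the rotated kernel is bounded, and it equals \<open>2 cosh (\<delta> \<tau>) K\<^bsub>i\<tau>\<^esub>(x)\<close>.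
\<close>

lemma macdonald_im_decay:
  assumes x: "x \<ge> 1" and \<delta>: "0 \<le> \<delta>" "\<delta> < pi / 2"
  shows "\<bar>macdonald_im \<tau> x\<bar> \<le> (LBINT v. exp (- (cos \<delta> * cosh v))) * exp (- (\<delta> * \<tau>))"
proof -
  define D where "D = (LBINT v. exp (- (cos \<delta> * cosh v)))"
  have cd: "cos \<delta> > 0" using \<delta> by (intro cos_gt_zero_pi) auto
  have iD: "integrable lborel (\<lambda>v. exp (- (cos \<delta> * cosh v)))" by (rule integrable_exp_cosh[OF cd])
  have bd: "\<bar>rotated_exp_cosh x \<delta> v * cos (\<tau> * v)\<bar> \<le> exp (- (cos \<delta> * cosh v))" for v
  proof -
    have "1 * (cos \<delta> * cosh v) \<le> x * (cos \<delta> * cosh v)" using x cd by (intro mult_right_mono) auto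
    hence "exp (- (x * cos \<delta> * cosh v)) \<le> exp (- (cos \<delta> * cosh v))" by (simp add: mult_ac)
    hence "\<bar>rotated_exp_cosh x \<delta> v\<bar> * \<bar>cos (\<tau> * v)\<bar> \<le> exp (- (cos \<delta> * cosh v)) * 1"
      using order_trans[OF abs_rotated_exp_cosh_le] by (intro mult_mono) auto
    thus ?thesis by (simp add: abs_mult)
  qed
  have "\<bar>LBINT v. rotated_exp_cosh x \<delta> v * cos (\<tau> * v)\<bar> \<le> (LBINT v. \<bar>rotated_exp_cosh x \<delta> v * cos (\<tau> * v)\<bar>)"
    by (rule integral_abs_bound)
  also have "\<dots> \<le> D"
    unfolding D_def
  proof (rule integral_mono)
    show "integrable lborel (\<lambda>v. \<bar>rotated_exp_cosh x \<delta> v * cos (\<tau> * v)\<bar>)"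
      by (rule Bochner_Integration.integrable_bound[OF iD]) (use bd in auto)
  qed (use iD bd in auto)
  finally have "2 * cosh (\<delta> * \<tau>) * \<bar>macdonald_im \<tau> x\<bar> \<le> D"
    using rotated_exp_cosh_cosine_transform[of x \<delta> \<tau>] x \<delta> by (simp add: abs_mult)
  moreover have "exp (\<delta> * \<tau>) * \<bar>macdonald_im \<tau> x\<bar> \<le> 2 * cosh (\<delta> * \<tau>) * \<bar>macdonald_im \<tau> x\<bar>"
    by (intro mult_right_mono) (auto simp: cosh_field_def)
  ultimately have "exp (\<delta> * \<tau>) * \<bar>macdonald_im \<tau> x\<bar> \<le> D" by linarith
  thus ?thesis unfolding D_def[symmetric] by (simp add: exp_minus field_simps)
qed

section \<open>The two expansions\<close>

lemma tendsto_integral_half_line: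
  fixes f :: "real \<Rightarrow> real"
  assumes "set_integrable lborel {0..} f"
  shows "((\<lambda>N. LBINT t:{0..N}. f t) \<longlongrightarrow> (LBINT t:{0..}. f t)) at_top"
proof -
  let ?g = "\<lambda>t. indicat_real {0..} t *\<^sub>R f t"
  have "((\<lambda>N. LBINT t:{-N..N}. ?g t) \<longlongrightarrow> (LBINT t. ?g t)) at_top"
    using assms by (intro tendsto_integral_symmetric_Icc) (simp add: set_integrable_def)
  moreover have "\<forall>\<^sub>F N in at_top. (LBINT t:{-N..N}. ?g t) = (LBINT t:{0..N}. f t)"
    using eventually_ge_at_top[of 0]
    by eventually_elim
       (auto simp: set_lebesgue_integral_def indicator_def intro!: Bochner_Integration.integral_cong)
  ultimately show ?thesis
    unfolding set_lebesgue_integral_def[of lborel "{0..}"] by (rule Lim_transform_eventually)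
qed

context
  fixes a :: "nat \<Rightarrow> complex"
  assumes a: "summable (\<lambda>k. norm (a (Suc k)))"
begin

lemma macdonald_K_series:
  shows "(\<lambda>m. a m * macdonald_K (\<i> * of_real \<tau>) (real m)) summable_on {1..}"
    and "(\<Sum>\<^sub>\<infinity>m\<in>{1..}. a m * macdonald_K (\<i> * of_real \<tau>) (real m)) =
           (\<Sum>k. a (Suc k) * of_real (macdonald_im \<tau> (real (Suc k))))"
    and "summable (\<lambda>k. a (Suc k) * of_real (macdonald_im \<tau> (real (Suc k))))"
proof -
  have K: "a (Suc k) * macdonald_K (\<i> * of_real \<tau>) (real (Suc k)) =
      a (Suc k) * of_real (macdonald_im \<tau> (real (Suc k)))" for k
    by (simp only: macdonald_K_imaginary[of "real (Suc k)"] of_nat_0_less_iff zero_less_Suc)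
  define D where "D = (LBINT v. exp (- (cos 0 * cosh (v::real))))"
  have "norm (a (Suc k) * of_real (macdonald_im \<tau> (real (Suc k)))) \<le> norm (a (Suc k)) * D" for k
    using macdonald_im_decay[of "real (Suc k)" 0 \<tau>]
    by (simp add: norm_mult D_def mult_left_mono)
  hence sm: "summable (\<lambda>k. norm (a (Suc k) * of_real (macdonald_im \<tau> (real (Suc k)))))"
    by (intro summable_comparison_test[OF _ summable_mult2[OF a, of D]]) auto
  show "summable (\<lambda>k. a (Suc k) * of_real (macdonald_im \<tau> (real (Suc k))))"
    by (rule summable_norm_cancel[OF sm])
  note sm' = sm[folded K]
  show "(\<lambda>m. a m * macdonald_K (\<i> * of_real \<tau>) (real m)) summable_on {1..}"
    by (rule infsum_atLeast_1_eq_suminf(1)[OF sm'])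
  show "(\<Sum>\<^sub>\<infinity>m\<in>{1..}. a m * macdonald_K (\<i> * of_real \<tau>) (real m)) =
           (\<Sum>k. a (Suc k) * of_real (macdonald_im \<tau> (real (Suc k))))"
    unfolding infsum_atLeast_1_eq_suminf(2)[OF sm'] K ..
qed

lemma macdonald_Ks_series:
  assumes w: "w \<ge> 0"
  shows "(\<lambda>m. a m * macdonald_Ks (real m) (\<i> * of_real \<tau>) w) summable_on {1..}"
    and "(\<Sum>\<^sub>\<infinity>m\<in>{1..}. a m * macdonald_Ks (real m) (\<i> * of_real \<tau>) w) =
           (\<Sum>k. a (Suc k) * macdonald_Ks (real (Suc k)) (\<i> * of_real \<tau>) w)"
    and "summable (\<lambda>k. a (Suc k) * macdonald_Ks (real (Suc k)) (\<i> * of_real \<tau>) w)"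
proof -
  have "norm (a (Suc k) * macdonald_Ks (real (Suc k)) (\<i> * of_real \<tau>) w)
      \<le> norm (a (Suc k)) * (w / \<bar>sinh (pi * \<tau> / 2)\<bar>)" for k
    unfolding norm_mult by (intro mult_left_mono norm_macdonald_Ks_le w) simp
  hence sm: "summable (\<lambda>k. norm (a (Suc k) * macdonald_Ks (real (Suc k)) (\<i> * of_real \<tau>) w))"
    by (intro summable_comparison_test[OF _ summable_mult2[OF a, of "w / \<bar>sinh (pi * \<tau> / 2)\<bar>"]]) auto
  show "summable (\<lambda>k. a (Suc k) * macdonald_Ks (real (Suc k)) (\<i> * of_real \<tau>) w)"
    by (rule summable_norm_cancel[OF sm])
  show "(\<lambda>m. a m * macdonald_Ks (real m) (\<i> * of_real \<tau>) w) summable_on {1..}"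
    by (rule infsum_atLeast_1_eq_suminf(1)[OF sm])
  show "(\<Sum>\<^sub>\<infinity>m\<in>{1..}. a m * macdonald_Ks (real m) (\<i> * of_real \<tau>) w) =
           (\<Sum>k. a (Suc k) * macdonald_Ks (real (Suc k)) (\<i> * of_real \<tau>) w)"
    by (rule infsum_atLeast_1_eq_suminf(2)[OF sm])
qed

end

lemma suminf_single_mode:
  fixes c :: "nat \<Rightarrow> complex"
  assumes "n \<ge> 1"
  shows "(\<Sum>k. c k * of_real (if Suc k = n then b else 0)) = c (n - 1) * of_real b"
proof -
  have "(\<Sum>k. c k * of_real (if Suc k = n then b else 0)) =
     (\<Sum>k\<in>{n - 1}. c k * of_real (if Suc k = n then b else 0))"
    using assms by (intro suminf_finite) auto
  thus ?thesis using assms by simp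
qed

text \<open>
  The pairing is continuous in \<open>\<alpha>\<close>, and at \<open>\<alpha> = pi / 2\<close> it is the orthogonality relation.
\<close>

lemma pairing_tendsto_at_left:
  assumes m: "m \<ge> 1" and n: "n \<ge> 1"
  shows "((\<lambda>\<alpha>. LBINT u:{0..arsinh pi}. cosine_mode n u * rotated_exp_cosh (real m) \<alpha> u)
           \<longlongrightarrow> (if m = n then pi / 2 else 0)) (at_left (pi / 2))"
proof -
  let ?w = "arsinh pi :: real"
  let ?I = "\<lambda>\<alpha>. integral (cbox 0 ?w) (\<lambda>u. cosine_mode n u * rotated_exp_cosh (real m) \<alpha> u)"
  have eq: "(LBINT u:{0..?w}. cosine_mode n u * rotated_exp_cosh (real m) \<alpha> u) = ?I \<alpha>" for \<alpha>
    unfolding cbox_interval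
    by (intro borel_set_integral_eq_integral_Icc continuous_intros continuous_on_cosine_mode)
  have "continuous_on UNIV ?I"
    unfolding cosine_mode_def rotated_exp_cosh_def
    by (intro integral_continuous_on_param) (auto simp: case_prod_beta' intro!: continuous_intros)
  hence "isCont ?I (pi / 2)" by (simp add: continuous_on_eq_continuous_at)
  hence "(?I \<longlongrightarrow> ?I (pi / 2)) (at_left (pi / 2))"
    unfolding isCont_def by (rule tendsto_within_subset) simp
  thus ?thesis using cosine_mode_orthogonal[OF n m] unfolding eq by (auto split: if_splits)
qed

lemma abs_pairing_le:
  assumes x: "x > 0" and c: "cos \<alpha> \<ge> 0" and w: "w \<ge> 0"
  shows "\<bar>LBINT u:{0..w}. cosine_mode n u * rotated_exp_cosh x \<alpha> u\<bar> \<le> cosh w * w"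
proof -
  have ct: "continuous_on {0..w} (\<lambda>u. cosine_mode n u * rotated_exp_cosh x \<alpha> u)"
    by (intro continuous_intros continuous_on_cosine_mode)
  have "norm (integral {0..w} (\<lambda>u. cosine_mode n u * rotated_exp_cosh x \<alpha> u)) \<le> cosh w * (w - 0)"
  proof (rule integral_bound[OF w ct])
    fix u assume u: "u \<in> {0..w}"
    have "exp (- (x * cos \<alpha> * cosh u)) \<le> 1" using x c by simp
    hence "\<bar>rotated_exp_cosh x \<alpha> u\<bar> \<le> 1" by (rule order_trans[OF abs_rotated_exp_cosh_le])
    thus "norm (cosine_mode n u * rotated_exp_cosh x \<alpha> u) \<le> cosh w"
      using mult_mono[OF abs_cosine_mode_le[OF u, of n], of _ 1] by (simp add: abs_mult)
  qed
  thus ?thesis by (simp add: borel_set_integral_eq_integral_Icc[OF ct])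
qed

lemma Abel_expansion:
  fixes a :: "nat \<Rightarrow> complex" and n :: nat
  defines "f \<equiv> (\<lambda>(\<alpha>::real) (\<tau>::real).
             of_real (\<tau> * sinh (pi * \<tau> / 2) * cosh (\<alpha> * \<tau>)) *
             macdonald_Ks (real n) (\<i> * of_real \<tau>) (arsinh pi) *
             (\<Sum>\<^sub>\<infinity>m\<in>{1..}. a m * macdonald_K (\<i> * of_real \<tau>) (real m)))"
  assumes a: "summable (\<lambda>k. norm (a (Suc k)))" and n: "n \<ge> 1"
  shows "\<alpha> \<in> {0<..<pi / 2} \<Longrightarrow> set_integrable lborel {0..} (f \<alpha>)"
    and "((\<lambda>\<alpha>. of_real (4 / (pi\<^sup>2 * real n)) * (LBINT \<tau>:{0..}. f \<alpha> \<tau>)) \<longlongrightarrow> a n) (at_left (pi / 2))"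
proof -
  define w where "w = (arsinh pi :: real)"
  have w: "w \<ge> 0" by (simp add: w_def arsinh_pi_nonneg)
  define H where "H = (\<lambda>\<alpha> k \<tau>. cosh (\<alpha> * \<tau>) * macdonald_im \<tau> (real (Suc k)) * cosine_transform (cosine_mode n) w \<tau>)"
  define T where "T = (\<lambda>k \<alpha>. pi / 2 * (LBINT u:{0..w}. cosine_mode n u * rotated_exp_cosh (real (Suc k)) \<alpha> u))"
  have [measurable]: "H \<alpha> k \<in> borel_measurable borel" for \<alpha> k
    unfolding H_def by measurable
  have f_eq: "f \<alpha> \<tau> = of_real (real n) * (\<Sum>k. a (Suc k) * of_real (H \<alpha> k \<tau>))" for \<alpha> \<tau>
  proof -
    have "f \<alpha> \<tau> = of_real (cosh (\<alpha> * \<tau>)) * (of_real (\<tau> * sinh (pi * \<tau> / 2)) * macdonald_Ks (real n) (\<i> * of_real \<tau>) (arsinh pi)) *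
             (\<Sum>k. a (Suc k) * of_real (macdonald_im \<tau> (real (Suc k))))"
      unfolding f_def macdonald_K_series(2)[OF a] by simp
    also have "\<dots> = of_real (real n * (cosh (\<alpha> * \<tau>) * cosine_transform (cosine_mode n) w \<tau>)) *
             (\<Sum>k. a (Suc k) * of_real (macdonald_im \<tau> (real (Suc k))))"
      unfolding sinh_times_macdonald_Ks w_def by simp
    also have "\<dots> = of_real (real n) * (of_real (cosh (\<alpha> * \<tau>) * cosine_transform (cosine_mode n) w \<tau>) *
             (\<Sum>k. a (Suc k) * of_real (macdonald_im \<tau> (real (Suc k)))))" by simp
    also have "of_real (cosh (\<alpha> * \<tau>) * cosine_transform (cosine_mode n) w \<tau>) *
             (\<Sum>k. a (Suc k) * of_real (macdonald_im \<tau> (real (Suc k)))) =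
          (\<Sum>k. of_real (cosh (\<alpha> * \<tau>) * cosine_transform (cosine_mode n) w \<tau>) *
             (a (Suc k) * of_real (macdonald_im \<tau> (real (Suc k)))))"
      by (rule suminf_mult[OF macdonald_K_series(3)[OF a], symmetric])
    also have "\<dots> = (\<Sum>k. a (Suc k) * of_real (H \<alpha> k \<tau>))"
      by (simp add: H_def mult_ac)
    finally show ?thesis .
  qed
  \<comment> \<open>for \<open>\<alpha> < pi / 2\<close> everything converges absolutely, and each term is evaluated by its truncations\<close>
  have main: "set_integrable lborel {0..} (\<lambda>\<tau>. \<Sum>k. a (Suc k) * of_real (H \<alpha> k \<tau>)) \<and>
      (LBINT \<tau>:{0..}. (\<Sum>k. a (Suc k) * of_real (H \<alpha> k \<tau>))) = (\<Sum>k. a (Suc k) * of_real (T k \<alpha>))"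
    if \<alpha>: "\<alpha> \<in> {0<..<pi / 2}" for \<alpha>
  proof -
    \<comment> \<open>any decay rate strictly between \<open>\<alpha>\<close> and \<open>pi / 2\<close> beats the growth of \<open>cosh (\<alpha> \<tau>)\<close>\<close>
    define \<delta> where "\<delta> = (\<alpha> + pi / 2) / 2"
    have d: "0 \<le> \<delta>" "\<delta> < pi / 2" "0 < \<delta> - \<alpha>" using \<alpha> by (auto simp: \<delta>_def field_simps)
    define D where "D = (LBINT v. exp (- (cos \<delta> * cosh (v::real))))"
    define W where "W = (\<lambda>\<tau>. (D * (cosh w * w)) * exp (- (\<tau> * (\<delta> - \<alpha>))))"
    have W: "set_integrable lborel {0..} W"
    proof -
      have "set_integrable lborel {0<..} W"
        unfolding W_def by (intro set_integrable_mult_right integrable_I0i_exp_mscale d)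
      moreover have "AE x in lborel. indicat_real {0<..} x *\<^sub>R W x = indicat_real {0..} x *\<^sub>R W x"
        using AE_lborel_singleton[of 0] by eventually_elim (auto simp: indicator_def)
      moreover have [measurable]: "W \<in> borel_measurable borel" unfolding W_def by measurable
      ultimately show ?thesis unfolding set_integrable_def
        by (subst integrable_cong_AE[where g = "\<lambda>x. indicat_real {0<..} x *\<^sub>R W x"]) (auto elim: AE_mp)
    qed
    have bd: "\<bar>H \<alpha> k \<tau>\<bar> \<le> W \<tau>" if \<tau>: "\<tau> \<in> {0..}" for k \<tau>
    proof -
      have "cosh (\<alpha> * \<tau>) \<le> exp (\<alpha> * \<tau>)"
      proof -
        have "exp (- (\<alpha> * \<tau>)) \<le> exp (\<alpha> * \<tau>)" using \<alpha> \<tau> by simp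
        thus ?thesis by (simp add: cosh_field_def)
      qed
      moreover have "\<bar>macdonald_im \<tau> (real (Suc k))\<bar> \<le> D * exp (- (\<delta> * \<tau>))"
        unfolding D_def by (rule macdonald_im_decay) (use d in auto)
      ultimately have "\<bar>H \<alpha> k \<tau>\<bar> \<le> (exp (\<alpha> * \<tau>) * (D * exp (- (\<delta> * \<tau>)))) * (cosh w * w)"
        unfolding H_def abs_mult
        using abs_cosine_transform_mode_le[OF w, of n \<tau>] by (intro mult_mono) auto
      also have "\<dots> = (D * (cosh w * w)) * (exp (\<alpha> * \<tau>) * exp (- (\<delta> * \<tau>)))" by simp
      also have "exp (\<alpha> * \<tau>) * exp (- (\<delta> * \<tau>)) = exp (- (\<tau> * (\<delta> - \<alpha>)))"
        by (simp add: algebra_simps flip: exp_add)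
      finally show ?thesis by (simp only: W_def)
    qed
    note S = set_integral_weighted_suminf[OF a _ _ W bd]
    have "(LBINT \<tau>:{0..}. H \<alpha> k \<tau>) = T k \<alpha>" for k
    proof (rule tendsto_unique[OF trivial_limit_at_top_linorder])
      show "((\<lambda>N. LBINT \<tau>:{0..N}. H \<alpha> k \<tau>) \<longlongrightarrow> (LBINT \<tau>:{0..}. H \<alpha> k \<tau>)) at_top"
        by (rule tendsto_integral_half_line[OF S(3)]) auto
      show "((\<lambda>N. LBINT \<tau>:{0..N}. H \<alpha> k \<tau>) \<longlongrightarrow> T k \<alpha>) at_top"
        unfolding H_def T_def
        by (rule truncated_Parseval_tendsto[where M = "cosh w"])
           (use \<alpha> abs_cosine_mode_le in auto)
    qed
    thus ?thesis using S(1,2) by simp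
  qed
  show "set_integrable lborel {0..} (f \<alpha>)" if "\<alpha> \<in> {0<..<pi / 2}" for \<alpha>
  proof -
    have "f \<alpha> = (\<lambda>\<tau>. of_real (real n) * (\<Sum>k. a (Suc k) * of_real (H \<alpha> k \<tau>)))" using f_eq by blast
    thus ?thesis using main[OF that] by (simp del: of_real_of_nat_eq)
  qed
  have int_f: "(LBINT \<tau>:{0..}. f \<alpha> \<tau>) = of_real (real n) * (\<Sum>k. a (Suc k) * of_real (T k \<alpha>))"
    if "\<alpha> \<in> {0<..<pi / 2}" for \<alpha>
    unfolding f_eq using main[OF that] by (simp del: of_real_of_nat_eq)
  have ev: "\<forall>\<^sub>F \<alpha> in at_left (pi / 2). \<alpha> \<in> {0<..<pi / 2}"
    by (rule eventually_at_leftI[of 0]) auto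
  have "((\<lambda>\<alpha>. \<Sum>k. a (Suc k) * of_real (T k \<alpha>)) \<longlongrightarrow>
      (\<Sum>k. a (Suc k) * of_real (if Suc k = n then pi\<^sup>2 / 4 else 0))) (at_left (pi / 2))"
  proof (rule tendsto_weighted_suminf[OF a, where M = "pi / 2 * (cosh w * w)"])
    show "(T k \<longlongrightarrow> (if Suc k = n then pi\<^sup>2 / 4 else 0)) (at_left (pi / 2))" for k
      unfolding T_def w_def
      using tendsto_mult[OF tendsto_const[of "pi / 2"] pairing_tendsto_at_left[of "Suc k" n]] n
      by (auto simp: power2_eq_square split: if_splits)
    show "\<forall>\<^sub>F \<alpha> in at_left (pi / 2). \<forall>k. \<bar>T k \<alpha>\<bar> \<le> pi / 2 * (cosh w * w)"
      using ev
    proof eventually_elim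
      case (elim \<alpha>)
      hence "cos \<alpha> \<ge> 0" by (intro cos_ge_zero) auto
      thus ?case
        unfolding T_def abs_mult using abs_pairing_le[OF _ _ w] by (auto intro!: mult_left_mono)
    qed
  qed simp
  hence "((\<lambda>\<alpha>. \<Sum>k. a (Suc k) * of_real (T k \<alpha>)) \<longlongrightarrow> a n * of_real (pi\<^sup>2 / 4)) (at_left (pi / 2))"
    using n by (simp only: suminf_single_mode Suc_diff_1[OF Suc_le_lessD[OF n[unfolded One_nat_def]]])
  hence "((\<lambda>\<alpha>. of_real (4 / (pi\<^sup>2 * real n)) * (of_real (real n) * (\<Sum>k. a (Suc k) * of_real (T k \<alpha>)))) \<longlongrightarrow>
      of_real (4 / (pi\<^sup>2 * real n)) * (of_real (real n) * (a n * of_real (pi\<^sup>2 / 4)))) (at_left (pi / 2))"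
    by (intro tendsto_mult tendsto_const)
  moreover have "of_real (4 / (pi\<^sup>2 * real n)) * (of_real (real n) * (a n * of_real (pi\<^sup>2 / 4))) = a n"
    using n by (simp add: field_simps)
  ultimately have "((\<lambda>\<alpha>. of_real (4 / (pi\<^sup>2 * real n)) * (of_real (real n) * (\<Sum>k. a (Suc k) * of_real (T k \<alpha>)))) \<longlongrightarrow> a n) (at_left (pi / 2))"
    by (simp only:)
  thus "((\<lambda>\<alpha>. of_real (4 / (pi\<^sup>2 * real n)) * (LBINT \<tau>:{0..}. f \<alpha> \<tau>)) \<longlongrightarrow> a n) (at_left (pi / 2))"
  proof (rule Lim_transform_eventually)
    show "\<forall>\<^sub>F \<alpha> in at_left (pi / 2). of_real (4 / (pi\<^sup>2 * real n)) * (of_real (real n) * (\<Sum>k. a (Suc k) * of_real (T k \<alpha>))) =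
        of_real (4 / (pi\<^sup>2 * real n)) * (LBINT \<tau>:{0..}. f \<alpha> \<tau>)"
      using ev by eventually_elim (simp only: int_f)
  qed
qed

lemma improper_expansion:
  fixes a :: "nat \<Rightarrow> complex" and n :: nat
  defines "g \<equiv> (\<lambda>\<tau>::real.
             of_real (\<tau> * sinh (pi * \<tau>)) *
             macdonald_K (\<i> * of_real \<tau>) (real n) *
             (\<Sum>\<^sub>\<infinity>m\<in>{1..}. a m * macdonald_Ks (real m) (\<i> * of_real \<tau>) (arsinh pi)))"
  assumes a: "summable (\<lambda>k. norm (a (Suc k)))" and ma: "summable (\<lambda>k. real (Suc k) * norm (a (Suc k)))"
    and n: "n \<ge> 1"
  shows "set_integrable lborel {0..N} g"
    and "((\<lambda>N. of_real (2 / (pi\<^sup>2 * real n)) * (LBINT \<tau>:{0..N}. g \<tau>)) \<longlongrightarrow> a n) at_top"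
proof -
  define w where "w = (arsinh pi :: real)"
  have w: "w \<ge> 0" by (simp add: w_def arsinh_pi_nonneg)
  have n0: "real n > 0" using n by simp
  define c where "c = (\<lambda>k. of_real (real (Suc k)) * a (Suc k))"
  have c: "summable (\<lambda>k. norm (c k))" using ma by (simp only: c_def norm_mult norm_of_real abs_of_nat)
  define H where "H = (\<lambda>k \<tau>. cosh (pi / 2 * \<tau>) * macdonald_im \<tau> (real n) * cosine_transform (cosine_mode (Suc k)) w \<tau>)"
  have [measurable]: "H k \<in> borel_measurable borel" for k
    unfolding H_def by measurable
  have g_eq: "g \<tau> = 2 * (\<Sum>k. c k * of_real (H k \<tau>))" for \<tau>
  proof -
    let ?C = "\<lambda>k. cosine_transform (cosine_mode (Suc k)) w \<tau>"
    let ?B = "cosh (pi / 2 * \<tau>) * macdonald_im \<tau> (real n)"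
    have "sinh (pi * \<tau>) = 2 * sinh (pi * \<tau> / 2) * cosh (pi / 2 * \<tau>)"
      using sinh_double[of "pi * \<tau> / 2"] by (simp add: mult_ac)
    hence "g \<tau> = 2 * of_real ?B * (of_real (\<tau> * sinh (pi * \<tau> / 2)) *
        (\<Sum>k. a (Suc k) * macdonald_Ks (real (Suc k)) (\<i> * of_real \<tau>) (arsinh pi)))"
      unfolding g_def macdonald_Ks_series(2)[OF a arsinh_pi_nonneg] macdonald_K_imaginary[OF n0] by simp
    also have "of_real (\<tau> * sinh (pi * \<tau> / 2)) *
        (\<Sum>k. a (Suc k) * macdonald_Ks (real (Suc k)) (\<i> * of_real \<tau>) (arsinh pi)) =
        (\<Sum>k. of_real (\<tau> * sinh (pi * \<tau> / 2)) * (a (Suc k) * macdonald_Ks (real (Suc k)) (\<i> * of_real \<tau>) (arsinh pi)))"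
      by (rule suminf_mult[OF macdonald_Ks_series(3)[OF a arsinh_pi_nonneg], symmetric])
    also have "\<dots> = (\<Sum>k. a (Suc k) * (of_real (\<tau> * sinh (pi * \<tau> / 2)) * macdonald_Ks (real (Suc k)) (\<i> * of_real \<tau>) (arsinh pi)))"
      by (simp only: mult_ac)
    also have "\<dots> = (\<Sum>k. c k * of_real (?C k))"
      unfolding sinh_times_macdonald_Ks w_def c_def by (simp only: of_real_mult mult_ac)
    also have "2 * of_real ?B * (\<Sum>k. c k * of_real (?C k)) = 2 * (of_real ?B * (\<Sum>k. c k * of_real (?C k)))"
      by simp
    also have "of_real ?B * (\<Sum>k. c k * of_real (?C k)) = (\<Sum>k. of_real ?B * (c k * of_real (?C k)))"
    proof (rule suminf_mult[symmetric])
      have "norm (c k * of_real (?C k)) \<le> norm (c k) * (cosh w * w)" for k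
        using abs_cosine_transform_mode_le[OF w] by (simp add: norm_mult mult_left_mono)
      hence "summable (\<lambda>k. norm (c k * of_real (?C k)))"
        by (intro summable_comparison_test[OF _ summable_mult2[OF c, of "cosh w * w"]]) auto
      thus "summable (\<lambda>k. c k * of_real (?C k))" by (rule summable_norm_cancel)
    qed
    also have "\<dots> = (\<Sum>k. c k * of_real (H k \<tau>))"
      by (simp only: H_def of_real_mult mult_ac)
    finally show ?thesis .
  qed
  have main: "set_integrable lborel {0..N} (\<lambda>\<tau>. \<Sum>k. c k * of_real (H k \<tau>))"
      "(LBINT \<tau>:{0..N}. (\<Sum>k. c k * of_real (H k \<tau>))) = (\<Sum>k. c k * of_real (LBINT \<tau>:{0..N}. H k \<tau>))" for N
  proof -
    define M where "M = cosh (pi / 2 * N) * macdonald_im 0 (real n) * (cosh w * w)"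
    have bd: "\<bar>H k \<tau>\<bar> \<le> M" if \<tau>: "\<tau> \<in> {0..N}" for k \<tau>
    proof -
      have "\<bar>cosh (pi / 2 * \<tau>) * macdonald_im \<tau> (real n)\<bar> \<le> cosh (pi / 2 * N) * macdonald_im 0 (real n)"
        by (rule abs_cosh_macdonald_im_le[OF n0 _ \<tau>]) simp
      thus ?thesis
        unfolding H_def M_def abs_mult[of _ "cosine_transform _ _ _"]
        using abs_cosine_transform_mode_le[OF w] by (intro mult_mono) auto
    qed
    have M: "set_integrable lborel {0..N} (\<lambda>_. M)" by (rule set_integrable_bounded_Icc[of _ _ _ "\<bar>M\<bar>"]) auto
    note S = set_integral_weighted_suminf[OF c _ _ M bd]
    show "set_integrable lborel {0..N} (\<lambda>\<tau>. \<Sum>k. c k * of_real (H k \<tau>))"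
      "(LBINT \<tau>:{0..N}. (\<Sum>k. c k * of_real (H k \<tau>))) = (\<Sum>k. c k * of_real (LBINT \<tau>:{0..N}. H k \<tau>))"
      using S(1,2) by simp_all
  qed
  have int_g: "(LBINT \<tau>:{0..N}. g \<tau>) = 2 * (\<Sum>k. c k * of_real (LBINT \<tau>:{0..N}. H k \<tau>))" for N
    unfolding g_eq using main(2) by simp
  show "set_integrable lborel {0..N} g"
  proof -
    have "g = (\<lambda>\<tau>. 2 * (\<Sum>k. c k * of_real (H k \<tau>)))" using g_eq by blast
    thus ?thesis using main(1) by simp
  qed
  obtain B where B: "\<And>N G M. N \<ge> 0 \<Longrightarrow> G \<in> borel_measurable borel \<Longrightarrow> (\<forall>u\<in>{0..w}. \<bar>G u\<bar> \<le> M) \<Longrightarrow>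
     \<bar>LBINT \<tau>:{0..N}. cosh (pi / 2 * \<tau>) * macdonald_im \<tau> (real n) * cosine_transform G w \<tau>\<bar> \<le> M * B"
    using truncated_Parseval_bounded[OF n0 pi_half_gt_zero order_refl w] by blast
  have "((\<lambda>N. \<Sum>k. c k * of_real (LBINT \<tau>:{0..N}. H k \<tau>)) \<longlongrightarrow>
      (\<Sum>k. c k * of_real (if Suc k = n then pi\<^sup>2 / 4 else 0))) at_top"
  proof (rule tendsto_weighted_suminf[OF c, where M = "cosh w * B"])
    show "((\<lambda>N. LBINT \<tau>:{0..N}. H k \<tau>) \<longlongrightarrow> (if Suc k = n then pi\<^sup>2 / 4 else 0)) at_top" for k
    proof -
      have "((\<lambda>N. LBINT \<tau>:{0..N}. H k \<tau>) \<longlongrightarrow>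
          pi / 2 * (LBINT u:{0..w}. cosine_mode (Suc k) u * rotated_exp_cosh (real n) (pi / 2) u)) at_top"
        unfolding H_def
        by (rule truncated_Parseval_tendsto[OF n0, where M = "cosh w"]) (use abs_cosine_mode_le in auto)
      thus ?thesis
        using cosine_mode_orthogonal[of "Suc k" n] n
        by (auto simp: w_def power2_eq_square split: if_splits)
    qed
    show "\<forall>\<^sub>F N in at_top. \<forall>k. \<bar>LBINT \<tau>:{0..N}. H k \<tau>\<bar> \<le> cosh w * B"
      using eventually_ge_at_top[of 0]
    proof eventually_elim
      case (elim N)
      show ?case unfolding H_def using B[OF elim] abs_cosine_mode_le by auto
    qed
  qed simp
  hence "((\<lambda>N. \<Sum>k. c k * of_real (LBINT \<tau>:{0..N}. H k \<tau>)) \<longlongrightarrow> c (n - 1) * of_real (pi\<^sup>2 / 4)) at_top"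
    using n by (simp only: suminf_single_mode)
  hence "((\<lambda>N. of_real (2 / (pi\<^sup>2 * real n)) * (2 * (\<Sum>k. c k * of_real (LBINT \<tau>:{0..N}. H k \<tau>)))) \<longlongrightarrow>
       of_real (2 / (pi\<^sup>2 * real n)) * (2 * (c (n - 1) * of_real (pi\<^sup>2 / 4)))) at_top"
    by (intro tendsto_mult tendsto_const)
  moreover have "of_real (2 / (pi\<^sup>2 * real n)) * (2 * (c (n - 1) * of_real (pi\<^sup>2 / 4))) = a n"
    using n by (simp add: c_def field_simps)
  ultimately show "((\<lambda>N. of_real (2 / (pi\<^sup>2 * real n)) * (LBINT \<tau>:{0..N}. g \<tau>)) \<longlongrightarrow> a n) at_top"
    unfolding int_g by (simp only:)
qed

theorem theorem4:
  fixes a :: "nat \<Rightarrow> complex"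
  assumes "(\<lambda>m. norm (a m)) summable_on {1..}"
  shows "(\<forall>n\<ge>1.
      (\<forall>\<tau>>0. (\<lambda>m. a m * macdonald_K (\<i> * of_real \<tau>) (real m)) summable_on {1..}) \<and>
      (let f = (\<lambda>(\<alpha>::real) (\<tau>::real).
             of_real (\<tau> * sinh (pi * \<tau> / 2) * cosh (\<alpha> * \<tau>)) *
             macdonald_Ks (real n) (\<i> * of_real \<tau>) (arsinh pi) *
             (\<Sum>\<^sub>\<infinity>m\<in>{1..}. a m * macdonald_K (\<i> * of_real \<tau>) (real m)))
       in (\<forall>\<alpha>\<in>{0<..<pi / 2}. set_integrable lborel {0..} (f \<alpha>)) \<and>
          ((\<lambda>\<alpha>. of_real (4 / (pi\<^sup>2 * real n)) * (LBINT \<tau>:{0..}. f \<alpha> \<tau>))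
             \<longlongrightarrow> a n) (at_left (pi / 2)))) \<and>
    ((\<lambda>m. real m * norm (a m)) summable_on {1..} \<longrightarrow>
     (\<forall>n\<ge>1.
      (\<forall>\<tau>>0. (\<lambda>m. a m * macdonald_Ks (real m) (\<i> * of_real \<tau>) (arsinh pi)) summable_on {1..}) \<and>
      (let g = (\<lambda>\<tau>::real.
             of_real (\<tau> * sinh (pi * \<tau>)) *
             macdonald_K (\<i> * of_real \<tau>) (real n) *
             (\<Sum>\<^sub>\<infinity>m\<in>{1..}. a m * macdonald_Ks (real m) (\<i> * of_real \<tau>) (arsinh pi)))
       in (\<forall>N>0. set_integrable lborel {0..N} g) \<and>
          ((\<lambda>N. of_real (2 / (pi\<^sup>2 * real n)) * (LBINT \<tau>:{0..N}. g \<tau>))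
             \<longlongrightarrow> a n) at_top)))"
proof -
  have a: "summable (\<lambda>k. norm (a (Suc k)))"
    using assms unfolding summable_on_atLeast_1_iff by (rule summable_on_imp_summable)
  have part1: "\<forall>n\<ge>1.
      (\<forall>\<tau>>0. (\<lambda>m. a m * macdonald_K (\<i> * of_real \<tau>) (real m)) summable_on {1..}) \<and>
      (let f = (\<lambda>(\<alpha>::real) (\<tau>::real).
             of_real (\<tau> * sinh (pi * \<tau> / 2) * cosh (\<alpha> * \<tau>)) *
             macdonald_Ks (real n) (\<i> * of_real \<tau>) (arsinh pi) *
             (\<Sum>\<^sub>\<infinity>m\<in>{1..}. a m * macdonald_K (\<i> * of_real \<tau>) (real m)))
       in (\<forall>\<alpha>\<in>{0<..<pi / 2}. set_integrable lborel {0..} (f \<alpha>)) \<and>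
          ((\<lambda>\<alpha>. of_real (4 / (pi\<^sup>2 * real n)) * (LBINT \<tau>:{0..}. f \<alpha> \<tau>))
             \<longlongrightarrow> a n) (at_left (pi / 2)))"
    unfolding Let_def using macdonald_K_series(1)[OF a] Abel_expansion[OF a] by blast
  have part2: "\<forall>n\<ge>1.
      (\<forall>\<tau>>0. (\<lambda>m. a m * macdonald_Ks (real m) (\<i> * of_real \<tau>) (arsinh pi)) summable_on {1..}) \<and>
      (let g = (\<lambda>\<tau>::real.
             of_real (\<tau> * sinh (pi * \<tau>)) *
             macdonald_K (\<i> * of_real \<tau>) (real n) *
             (\<Sum>\<^sub>\<infinity>m\<in>{1..}. a m * macdonald_Ks (real m) (\<i> * of_real \<tau>) (arsinh pi)))
       in (\<forall>N>0. set_integrable lborel {0..N} g) \<and>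
          ((\<lambda>N. of_real (2 / (pi\<^sup>2 * real n)) * (LBINT \<tau>:{0..N}. g \<tau>))
             \<longlongrightarrow> a n) at_top)"
    if "(\<lambda>m. real m * norm (a m)) summable_on {1..}"
  proof -
    have ma: "summable (\<lambda>k. real (Suc k) * norm (a (Suc k)))"
      using that unfolding summable_on_atLeast_1_iff by (rule summable_on_imp_summable)
    show ?thesis
      unfolding Let_def using macdonald_Ks_series(1)[OF a arsinh_pi_nonneg] improper_expansion[OF a ma] by blast
  qed
  show ?thesis using part1 part2 by blast
qed

end
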